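(* For any $d\in\mathbb{N}$, $a>0$ and $r\in(0,1]$ there exist $C,b>0$ such that: if $\Omega\in\mathbb{K}_d(r)$, then there exists a $C^\infty$ plurisubharmonic function $F:\Omega\to[0,1]$ with $$i\partial\bar\partial F(z)\ge C\,i\partial\bar\partial\|z\|^2\quad\text{on } \mathbb{B}_d(e_1;a)\cap\Omega$$ and $$\mathrm{supp}(F)\subset\mathbb{B}_d(e_1;b)\cap\Omega.$$
   Context: $\mathbb{B}_d(z_0;\rho)=\{z\in\mathbb{C}^d:\|z-z_0\|<\rho\}$ with the Euclidean norm, and $\mathrm{supp}(F)$ is the support of $F$ in $\Omega$. A convex domain in $\mathbb{C}^d$ is $\mathbb{C}$-properly convex if it contains no entire complex affine line. With $e_1,\dots,e_d$ the standard basis of $\mathbb{C}^d$ and $\mathbb{D}\subset\mathbb{C}$ the open unit disk, for $r\in(0,1]$ the set $\mathbb{K}_d(r)$ consists of the $\mathbb{C}$-properly convex domains $\Omega\subset\mathbb{C}^d$ such that (i) $r\mathbb{D}\cdot e_1\subset\Omega$ and $\mathbb{D}\cdot e_j\subset\Omega$ for $j=2,\dots,d$; and (ii) for every $j=1,\dots,d$, $e_j\in\partial\Omega$ and $(e_j+\mathrm{Span}_{\mathbb{C}}\{e_{j+1},\dots,e_d\})\cap\Omega=\emptyset$. *)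

theory Defs
  imports "HOL-Analysis.Analysis"
begin

text \<open>
  \<open>\<complex>\<^sup>d\<close> is the type \<open>complex ^ 'n\<close> with \<open>CARD('n) = d\<close>, whose norm is the Euclidean one.
  The order on the index type is needed to speak of \<open>e\<^sub>1\<close> and of the indices after \<open>j\<close>;
  complex scaling is \<open>*s\<close>, so that complex linear spans are \<open>vec.span\<close>.
\<close>

definition std_basis :: "'n \<Rightarrow> complex ^ 'n::finite" where
  "std_basis j = axis j 1"

definition first_index :: "'n::{finite,linorder}" where
  "first_index = Min UNIV"

definition C_properly_convex :: "(complex ^ 'n::finite) set \<Rightarrow> bool" where
  "C_properly_convex \<Omega> \<longleftrightarrow>
     open \<Omega> \<and> \<Omega> \<noteq> {} \<and> convex \<Omega> \<and>
     \<not> (\<exists>p v. v \<noteq> 0 \<and> (\<forall>\<zeta>::complex. p + \<zeta> *s v \<in> \<Omega>))"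

definition K_class :: "real \<Rightarrow> (complex ^ 'n::{finite,linorder}) set set" where
  "K_class r = {\<Omega>. C_properly_convex \<Omega> \<and>
     (\<forall>\<zeta>::complex. norm \<zeta> < r \<longrightarrow> \<zeta> *s std_basis first_index \<in> \<Omega>) \<and>
     (\<forall>j. j \<noteq> first_index \<longrightarrow> (\<forall>\<zeta>::complex. norm \<zeta> < 1 \<longrightarrow> \<zeta> *s std_basis j \<in> \<Omega>)) \<and>
     (\<forall>j. std_basis j \<in> frontier \<Omega> \<and>
          (\<lambda>v. std_basis j + v) ` vec.span {std_basis k |k. j < k} \<inter> \<Omega> = {})}"

primrec times_cont_differentiable_on ::
    "nat \<Rightarrow> 'a::real_normed_vector set \<Rightarrow> ('a \<Rightarrow> 'b::real_normed_vector) \<Rightarrow> bool" where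
  "times_cont_differentiable_on 0 S f \<longleftrightarrow> continuous_on S f"
| "times_cont_differentiable_on (Suc n) S f \<longleftrightarrow>
     (\<forall>x\<in>S. f differentiable (at x)) \<and>
     (\<forall>v. times_cont_differentiable_on n S (\<lambda>x. frechet_derivative f (at x) v))"

text \<open>Intended for open sets \<open>S\<close>, since the derivatives are taken in full neighbourhoods.\<close>

definition smooth_on :: "'a::real_normed_vector set \<Rightarrow> ('a \<Rightarrow> 'b::real_normed_vector) \<Rightarrow> bool" where
  "smooth_on S f \<longleftrightarrow> (\<forall>n. times_cont_differentiable_on n S f)"

definition upper_semicontinuous_on :: "'a::topological_space set \<Rightarrow> ('a \<Rightarrow> real) \<Rightarrow> bool" where
  "upper_semicontinuous_on S u \<longleftrightarrow>
     (\<forall>x\<in>S. \<forall>c. u x < c \<longrightarrow> (\<forall>\<^sub>F y in at x within S. u y < c))"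

text \<open>
  Plurisubharmonicity of real-valued (nowhere \<open>-\<infinity>\<close>) functions: upper semicontinuity and the
  sub-mean value inequality on every closed disc of a complex line inside \<open>\<Omega>\<close>. For such functions
  integrability over the circles is automatic; it is required explicitly only because
  \<open>integral\<close> is a total function.
\<close>

definition plurisubharmonic_on :: "(complex ^ 'n::finite) set \<Rightarrow> (complex ^ 'n \<Rightarrow> real) \<Rightarrow> bool" where
  "plurisubharmonic_on \<Omega> u \<longleftrightarrow>
     upper_semicontinuous_on \<Omega> u \<and>
     (\<forall>z w. (\<forall>\<zeta>::complex. norm \<zeta> \<le> 1 \<longrightarrow> z + \<zeta> *s w \<in> \<Omega>) \<longrightarrow>
        (\<lambda>\<theta>. u (z + cis \<theta> *s w)) absolutely_integrable_on {0..2 * pi} \<and>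
        u z \<le> 1 / (2 * pi) * integral {0..2 * pi} (\<lambda>\<theta>. u (z + cis \<theta> *s w)))"

text \<open>The Wirtinger operators \<open>\<partial>/\<partial>z\<^sub>j = (\<partial>/\<partial>x\<^sub>j - \<i> \<partial>/\<partial>y\<^sub>j)/2\<close> and their conjugates.\<close>

definition d_z :: "'n \<Rightarrow> (complex ^ 'n::finite \<Rightarrow> complex) \<Rightarrow> complex ^ 'n \<Rightarrow> complex" where
  "d_z j f z = (frechet_derivative f (at z) (axis j 1)
                - \<i> * frechet_derivative f (at z) (axis j \<i>)) / 2"

definition d_zbar :: "'n \<Rightarrow> (complex ^ 'n::finite \<Rightarrow> complex) \<Rightarrow> complex ^ 'n \<Rightarrow> complex" where
  "d_zbar j f z = (frechet_derivative f (at z) (axis j 1)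
                   + \<i> * frechet_derivative f (at z) (axis j \<i>)) / 2"

text \<open>
  The Hermitian form with coefficients \<open>\<partial>\<^sup>2f/\<partial>z\<^sub>j\<partial>zbar\<^sub>k\<close> associated with the real
  \<open>(1,1)\<close>-form \<open>\<i>\<partial>\<partial>bar f\<close>. For real-valued \<open>f\<close> of class \<open>C\<^sup>2\<close> the sum is real, so
  that \<open>Re\<close> only fixes the type. An inequality of real \<open>(1,1)\<close>-forms at a point is the
  inequality of these quadratic forms on all vectors.
\<close>

definition levi_form :: "(complex ^ 'n::finite \<Rightarrow> real) \<Rightarrow> complex ^ 'n \<Rightarrow> complex ^ 'n \<Rightarrow> real" where
  "levi_form f z v =
     Re (\<Sum>j\<in>UNIV. \<Sum>k\<in>UNIV.
           d_z j (d_zbar k (\<lambda>w. complex_of_real (f w))) z * (v $ j) * cnj (v $ k))"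

definition support_in :: "'a::topological_space set \<Rightarrow> ('a \<Rightarrow> real) \<Rightarrow> 'a set" where
  "support_in \<Omega> f = closure {z \<in> \<Omega>. f z \<noteq> 0} \<inter> \<Omega>"

end

theory Submission
  imports Defs "HOL-Complex_Analysis.Cauchy_Integral_Formula"
begin

text \<open>
  Separating \<open>\<Omega>\<close> from the affine subspaces in (ii) yields a triangular system of linear forms \<open>\<ell>\<^sub>j\<close>
  with \<open>Re \<ell>\<^sub>j < 1\<close> on \<open>\<Omega>\<close>; the discs in (i) bound its coefficients by \<open>1/r\<close>, so the system is
  invertible with constants depending only on \<open>d\<close> and \<open>r\<close>. On the half spaces \<open>Re \<ell>\<^sub>j < 1\<close> the functions
  \<open>g\<^sub>j = 1/(2 - \<ell>\<^sub>j)\<close> are bounded by \<open>1\<close>, hence \<open>h = \<Prod>\<^sub>j g\<^sub>j\<close> tends to \<open>0\<close> at infinity, and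
  \<open>u = |h|\<^sup>2 + \<Sum>\<^sub>i |h g\<^sub>i|\<^sup>2\<close> is strictly plurisubharmonic with quantitative bounds on compact sets.
  If \<open>u \<ge> \<delta>\<close> on the ball of radius \<open>a\<close>, a multiple of \<open>\<phi>(u - \<delta>/2)\<close> is the function sought, where
  \<open>\<phi>(t) = t exp(-1/t)\<close> for \<open>t > 0\<close> and \<open>\<phi>(t) = 0\<close> otherwise, which is smooth, convex and nondecreasing.
\<close>

unbundle no fps_syntax

section \<open>Closure properties of smooth functions\<close>

text \<open>Equality on an open set holds near each of its points and so passes to
  \<open>frechet_derivative\<close>. Both functions vary in the induction because it is applied to
  their directional derivatives.\<close>

lemma times_cont_differentiable_on_cong:
  assumes "open S" "\<And>x. x \<in> S \<Longrightarrow> f x = g x" "times_cont_differentiable_on n S f"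
  shows "times_cont_differentiable_on n S g"
  using assms(2,3)
proof (induction n arbitrary: f g)
  case 0
  then show ?case by (simp cong: continuous_on_cong)
next
  case (Suc n)
  have D: "(g has_derivative frechet_derivative f (at x)) (at x)" if "x \<in> S" for x
  proof (rule has_derivative_transform_within_open[OF _ assms(1) that])
    show "(f has_derivative frechet_derivative f (at x)) (at x)"
      using Suc.prems(2) that frechet_derivative_works by auto
  qed (rule Suc.prems(1))
  have "frechet_derivative f (at x) = frechet_derivative g (at x)" if "x \<in> S" for x
    using frechet_derivative_at[OF D[OF that]] .
  moreover have "g differentiable (at x)" if "x \<in> S" for x
    using D[OF that] by (auto simp: differentiable_def)
  ultimately show ?case
    using Suc.prems(2)
      Suc.IH[of "\<lambda>x. frechet_derivative f (at x) v" "\<lambda>x. frechet_derivative g (at x) v" for v]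
    by simp
qed

text \<open>Allows an explicit derivative formula in place of \<open>frechet_derivative\<close>; the
  basic closure properties below rest on this rule.\<close>

lemma times_cont_differentiable_on_SucI:
  assumes "open S" "\<And>x. x \<in> S \<Longrightarrow> (f has_derivative f' x) (at x)"
    and "\<And>v. times_cont_differentiable_on n S (\<lambda>x. f' x v)"
  shows "times_cont_differentiable_on (Suc n) S f"
proof -
  have "f' x = frechet_derivative f (at x)" if "x \<in> S" for x
    using frechet_derivative_at[OF assms(2)[OF that]] .
  then have "times_cont_differentiable_on n S (\<lambda>x. frechet_derivative f (at x) v)" for v
    using times_cont_differentiable_on_cong[OF assms(1) _ assms(3)[of v]] by simp
  then show ?thesis
    using assms(2) by (auto simp: differentiable_def)
qed

lemma times_cont_differentiable_on_SucD:
  "times_cont_differentiable_on (Suc n) S f \<Longrightarrow> times_cont_differentiable_on n S f"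
proof (induction n arbitrary: f)
  case 0
  then show ?case
    by (auto intro!: continuous_at_imp_continuous_on differentiable_imp_continuous_within)
next
  case (Suc n)
  from Suc.prems have "times_cont_differentiable_on (Suc n) S (\<lambda>x. frechet_derivative f (at x) v)" for v
    by simp
  from Suc.IH[OF this] Suc.prems show ?case by simp
qed

lemma times_cont_differentiable_on_has_derivative:
  "times_cont_differentiable_on (Suc n) S f \<Longrightarrow> x \<in> S \<Longrightarrow>
    (f has_derivative frechet_derivative f (at x)) (at x)"
  by (simp add: frechet_derivative_works)

lemma times_cont_differentiable_on_const:
  "open S \<Longrightarrow> times_cont_differentiable_on n S (\<lambda>x. c)"
proof (induction n arbitrary: c)
  case (Suc n)
  show ?case
    by (rule times_cont_differentiable_on_SucI[of _ _ "\<lambda>x v. 0"]) (auto intro: Suc)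
qed simp

lemma times_cont_differentiable_on_linear:
  assumes "open S" "bounded_linear L"
  shows "times_cont_differentiable_on n S L"
proof (cases n)
  case 0
  then show ?thesis by (simp add: assms(2) linear_continuous_on)
next
  case (Suc m)
  show ?thesis unfolding Suc
    by (rule times_cont_differentiable_on_SucI[of _ _ "\<lambda>x. L"])
      (auto intro: times_cont_differentiable_on_const bounded_linear_imp_has_derivative assms)
qed

lemma times_cont_differentiable_on_linear_compose:
  assumes "open S" "bounded_linear L" "times_cont_differentiable_on n S f"
  shows "times_cont_differentiable_on n S (\<lambda>x. L (f x))"
  using assms(3)
proof (induction n arbitrary: f)
  case 0
  then show ?case by (simp add: bounded_linear.continuous_on[OF assms(2)])
next
  case (Suc n)
  show ?case
  proof (rule times_cont_differentiable_on_SucI[OF assms(1)])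
    show "((\<lambda>x. L (f x)) has_derivative (\<lambda>v. L (frechet_derivative f (at x) v))) (at x)" if "x \<in> S" for x
      using bounded_linear.has_derivative[OF assms(2)]
        times_cont_differentiable_on_has_derivative[OF Suc.prems that] .
    show "times_cont_differentiable_on n S (\<lambda>x. L (frechet_derivative f (at x) v))" for v
      using Suc.prems by (intro Suc.IH) simp
  qed
qed

lemma times_cont_differentiable_on_add:
  assumes "open S" "times_cont_differentiable_on n S f" "times_cont_differentiable_on n S g"
  shows "times_cont_differentiable_on n S (\<lambda>x. f x + g x)"
  using assms(2,3)
proof (induction n arbitrary: f g)
  case 0
  then show ?case by (simp add: continuous_on_add)
next
  case (Suc n)
  show ?case
  proof (rule times_cont_differentiable_on_SucI[OF assms(1)])
    show "((\<lambda>x. f x + g x) has_derivative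
        (\<lambda>v. frechet_derivative f (at x) v + frechet_derivative g (at x) v)) (at x)" if "x \<in> S" for x
      using has_derivative_add Suc.prems[THEN times_cont_differentiable_on_has_derivative, OF that] .
    show "times_cont_differentiable_on n S
        (\<lambda>x. frechet_derivative f (at x) v + frechet_derivative g (at x) v)" for v
      using Suc.prems by (intro Suc.IH) simp_all
  qed
qed

lemma times_cont_differentiable_on_mult:
  fixes f g :: "'a::real_normed_vector \<Rightarrow> 'b::real_normed_algebra"
  assumes "open S" "times_cont_differentiable_on n S f" "times_cont_differentiable_on n S g"
  shows "times_cont_differentiable_on n S (\<lambda>x. f x * g x)"
  using assms(2,3)
proof (induction n arbitrary: f g)
  case 0
  then show ?case by (simp add: continuous_on_mult)
next
  case (Suc n)
  show ?case
  proof (rule times_cont_differentiable_on_SucI[OF assms(1)])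
    show "((\<lambda>x. f x * g x) has_derivative
        (\<lambda>v. f x * frechet_derivative g (at x) v + frechet_derivative f (at x) v * g x)) (at x)"
      if "x \<in> S" for x
      using has_derivative_mult Suc.prems[THEN times_cont_differentiable_on_has_derivative, OF that] .
    show "times_cont_differentiable_on n S
        (\<lambda>x. f x * frechet_derivative g (at x) v + frechet_derivative f (at x) v * g x)" for v
      \<comment> \<open>Each term of the product rule keeps one undifferentiated factor, whose order
        has to be lowered to n.\<close>
      using Suc.prems Suc.prems[THEN times_cont_differentiable_on_SucD]
      by (intro times_cont_differentiable_on_add Suc.IH assms(1)) simp_all
  qed
qed

text \<open>The derivative of 1/f is built from 1/f itself and the derivative of f, so the induction
  runs with f fixed.\<close>

lemma times_cont_differentiable_on_inverse:
  fixes f :: "'a::real_normed_vector \<Rightarrow> 'b::real_normed_field"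
  assumes "open S" "\<And>x. x \<in> S \<Longrightarrow> f x \<noteq> 0" "times_cont_differentiable_on n S f"
  shows "times_cont_differentiable_on n S (\<lambda>x. inverse (f x))"
  using assms(3)
proof (induction n)
  case 0
  then show ?case using assms(2) by (auto intro: continuous_on_inverse)
next
  case (Suc n)
  have IH: "times_cont_differentiable_on n S (\<lambda>x. inverse (f x))"
    using Suc.IH[OF times_cont_differentiable_on_SucD[OF Suc.prems]] .
  have "times_cont_differentiable_on n S
          (\<lambda>x. (- 1) * (inverse (f x) * frechet_derivative f (at x) v * inverse (f x)))" for v
    using Suc.prems
    by (intro times_cont_differentiable_on_mult times_cont_differentiable_on_const IH assms(1)) auto
  then have D: "times_cont_differentiable_on n S
          (\<lambda>x. - (inverse (f x) * frechet_derivative f (at x) v * inverse (f x)))" for v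
    by simp
  show ?case
  proof (rule times_cont_differentiable_on_SucI[OF assms(1) _ D])
    show "((\<lambda>x. inverse (f x)) has_derivative
        (\<lambda>v. - (inverse (f x) * frechet_derivative f (at x) v * inverse (f x)))) (at x)"
      if "x \<in> S" for x
      using Deriv.has_derivative_inverse[of f x, OF assms(2)[OF that]]
        times_cont_differentiable_on_has_derivative[OF Suc.prems that] .
  qed
qed

lemma times_cont_differentiable_on_sum:
  assumes "open S" "\<And>i. i \<in> I \<Longrightarrow> times_cont_differentiable_on n S (f i)"
  shows "times_cont_differentiable_on n S (\<lambda>x. \<Sum>i\<in>I. f i x)"
  using assms(2)
  by (induction I rule: infinite_finite_induct)
    (auto intro: times_cont_differentiable_on_const times_cont_differentiable_on_add assms(1))

lemma times_cont_differentiable_on_prod: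
  fixes f :: "'i \<Rightarrow> 'a::real_normed_vector \<Rightarrow> 'b::real_normed_field"
  assumes "open S" "\<And>i. i \<in> I \<Longrightarrow> times_cont_differentiable_on n S (f i)"
  shows "times_cont_differentiable_on n S (\<lambda>x. \<Prod>i\<in>I. f i x)"
  using assms(2)
  by (induction I rule: infinite_finite_induct)
    (auto intro: times_cont_differentiable_on_const times_cont_differentiable_on_mult assms(1))

section \<open>A convex smooth cut-off function\<close>

text \<open>A whole family is introduced because the derivatives of its members are linear
  combinations of members, which turns smoothness at 0 into an induction.\<close>

definition flat_exp :: "nat \<Rightarrow> real \<Rightarrow> real" where
  "flat_exp k t = (if t > 0 then exp (- 1 / t) / t ^ k else 0)"

lemma flat_exp_nonneg: "flat_exp k t \<ge> 0"
  by (simp add: flat_exp_def)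

lemma flat_exp_tendsto_0: "(flat_exp k \<longlongrightarrow> 0) (at 0)"
proof -
  \<comment> \<open>Substituting x = 1/t reduces the right-hand limit to the decay of x^k / exp x at
    infinity.\<close>
  have "((\<lambda>t::real. inverse t ^ k / exp (inverse t)) \<longlongrightarrow> 0) (at_right 0)"
    using filterlim_compose[OF tendsto_power_div_exp_0 filterlim_inverse_at_top_right] .
  moreover have "\<forall>\<^sub>F t in at_right 0. inverse t ^ k / exp (inverse t) = flat_exp k t"
    using eventually_at_right_less
    by eventually_elim (simp add: flat_exp_def exp_minus field_simps)
  ultimately have "(flat_exp k \<longlongrightarrow> 0) (at_right 0)"
    by (rule Lim_transform_eventually)
  moreover have "\<forall>\<^sub>F t in at_left 0. 0 = flat_exp k t"
    by (auto simp: flat_exp_def eventually_at_filter)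
  then have "(flat_exp k \<longlongrightarrow> 0) (at_left 0)"
    by (rule Lim_transform_eventually[OF tendsto_const])
  ultimately show ?thesis
    by (simp add: filterlim_at_split)
qed

lemma flat_exp_has_derivative:
  "(flat_exp k has_real_derivative flat_exp (k + 2) t - real k * flat_exp (k + 1) t) (at t)"
proof -
  consider "t < 0" | "t = 0" | "t > 0" by linarith
  then show ?thesis
  proof cases
    case 1
    have "((\<lambda>x. 0) has_real_derivative 0) (at t)" by simp
    then have "(flat_exp k has_real_derivative 0) (at t)"
      by (rule has_field_derivative_transform_within_open[where S="{..<0}"]) (use 1 in \<open>auto simp: flat_exp_def\<close>)
    then show ?thesis using 1 by (simp add: flat_exp_def)
  next
    case 2
    \<comment> \<open>The difference quotient at 0 is the next member of the family, also at h = 0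
      because division by 0 yields 0.\<close>
    have "(\<lambda>h. (flat_exp k (0 + h) - flat_exp k 0) / h) = flat_exp (Suc k)"
      by (auto simp: flat_exp_def fun_eq_iff)
    then show ?thesis
      using flat_exp_tendsto_0[of "Suc k"] 2 by (simp add: DERIV_def flat_exp_def)
  next
    case 3
    have "((\<lambda>t. exp (- 1 / t) / t ^ k) has_real_derivative
        (exp (- 1 / t) * (1 / t\<^sup>2) * t ^ k - exp (- 1 / t) * (real k * t ^ (k - 1))) / (t ^ k * t ^ k)) (at t)"
      using 3 by (auto intro!: derivative_eq_intros simp: power2_eq_square)
    also have "(exp (- 1 / t) * (1 / t\<^sup>2) * t ^ k - exp (- 1 / t) * (real k * t ^ (k - 1))) / (t ^ k * t ^ k)
      = exp (- 1 / t) / t ^ (k + 2) - real k * (exp (- 1 / t) / t ^ (k + 1))"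
      using 3 by (cases k) (simp_all add: diff_divide_distrib power2_eq_square)
    finally have "((\<lambda>t. exp (- 1 / t) / t ^ k) has_real_derivative
        exp (- 1 / t) / t ^ (k + 2) - real k * (exp (- 1 / t) / t ^ (k + 1))) (at t)" .
    then have "(flat_exp k has_real_derivative
        exp (- 1 / t) / t ^ (k + 2) - real k * (exp (- 1 / t) / t ^ (k + 1))) (at t)"
      by (rule has_field_derivative_transform_within_open[where S="{0<..}"]) (use 3 in \<open>auto simp: flat_exp_def\<close>)
    then show ?thesis using 3 by (simp add: flat_exp_def)
  qed
qed

text \<open>Differentiation raises k by 1 and by 2, so the induction treats all k at once.\<close>

lemma times_cont_differentiable_on_flat_exp:
  assumes "open S" "times_cont_differentiable_on n S f"
  shows "times_cont_differentiable_on n S (\<lambda>x. flat_exp k (f x))"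
  using assms(2)
proof (induction n arbitrary: k)
  case 0
  have "continuous_on UNIV (flat_exp k)"
    by (intro continuous_at_imp_continuous_on ballI DERIV_isCont[OF flat_exp_has_derivative])
  then show ?case
    using 0 continuous_on_compose2[of UNIV "flat_exp k" S f] by simp
next
  case (Suc n)
  have IH: "times_cont_differentiable_on n S (\<lambda>x. flat_exp k (f x))" for k
    using Suc.IH[OF times_cont_differentiable_on_SucD[OF Suc.prems]] .
  have "times_cont_differentiable_on n S (\<lambda>x. frechet_derivative f (at x) v *
        (flat_exp (k + 2) (f x) + (- real k) * flat_exp (k + 1) (f x)))" for v
    using Suc.prems
    by (intro times_cont_differentiable_on_mult times_cont_differentiable_on_const
        times_cont_differentiable_on_add IH assms(1)) auto
  then have D: "times_cont_differentiable_on n S (\<lambda>x. frechet_derivative f (at x) v *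
        (flat_exp (k + 2) (f x) - real k * flat_exp (k + 1) (f x)))" for v
    by simp
  show ?case
  proof (rule times_cont_differentiable_on_SucI[OF assms(1) _ D])
    show "((\<lambda>x. flat_exp k (f x)) has_derivative (\<lambda>v. frechet_derivative f (at x) v *
        (flat_exp (k + 2) (f x) - real k * flat_exp (k + 1) (f x)))) (at x)" if "x \<in> S" for x
      using DERIV_compose_FDERIV[OF flat_exp_has_derivative]
        times_cont_differentiable_on_has_derivative[OF Suc.prems that] .
  qed
qed

text \<open>The factor t secures convexity on the whole line: exp(-1/t) alone is concave for t >
  1/2, whereas here the second derivative is exp(-1/t)/t^3 for t > 0.\<close>

definition convex_cutoff :: "real \<Rightarrow> real" where
  "convex_cutoff t = t * flat_exp 0 t"

lemma convex_cutoff_has_derivative: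
  "(convex_cutoff has_real_derivative flat_exp 0 t + flat_exp 1 t) (at t)"
  unfolding convex_cutoff_def[abs_def]
  by (rule derivative_eq_intros flat_exp_has_derivative | simp)+
    \<comment> \<open>The product rule leaves \<open>t * flat_exp 2 t\<close>, which equals
      \<open>flat_exp 1 t\<close> for every real t.\<close>
    (simp add: flat_exp_def power2_eq_square)

lemma convex_cutoff_has_second_derivative:
  "((\<lambda>t. flat_exp 0 t + flat_exp 1 t) has_real_derivative flat_exp 3 t) (at t)"
  by (rule derivative_eq_intros flat_exp_has_derivative | simp)+
    (simp add: eval_nat_numeral)

lemma convex_cutoff_derivative_mono:
  assumes "s \<le> t"
  shows "flat_exp 0 s + flat_exp 1 s \<le> flat_exp 0 t + flat_exp 1 t"
  using DERIV_nonneg_imp_nondecreasing[OF assms, of "\<lambda>t. flat_exp 0 t + flat_exp 1 t"]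
    convex_cutoff_has_second_derivative flat_exp_nonneg by blast

lemma convex_cutoff_above_tangent:
  "convex_cutoff t \<ge> convex_cutoff s + (flat_exp 0 s + flat_exp 1 s) * (t - s)"
proof -
  have "convex_on UNIV convex_cutoff"
    by (rule f''_ge0_imp_convex[OF _ convex_cutoff_has_derivative convex_cutoff_has_second_derivative])
      (auto simp: flat_exp_nonneg)
  then have "convex_cutoff t - convex_cutoff s \<ge> (flat_exp 0 s + flat_exp 1 s) * (t - s)"
    using convex_on_imp_above_tangent[of UNIV convex_cutoff s t "flat_exp 0 s + flat_exp 1 s"]
      convex_cutoff_has_derivative by simp
  then show ?thesis by simp
qed

section \<open>Complex differentiability and Wirtinger derivatives\<close>

text \<open>Complex linearity of the real derivative encodes the Cauchy-Riemann equations in all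
  variables, in a form that fits the Wirtinger operators, which are built from real
  derivatives.\<close>

definition complex_differentiable_at :: "(complex ^ 'n::finite \<Rightarrow> complex) \<Rightarrow> complex ^ 'n \<Rightarrow> bool" where
  "complex_differentiable_at f z \<longleftrightarrow>
     (\<exists>L. (f has_derivative L) (at z) \<and> (\<forall>c v. L (c *s v) = c * L v))"

lemma complex_differentiable_atI:
  "(f has_derivative L) (at z) \<Longrightarrow> (\<And>c v. L (c *s v) = c * L v) \<Longrightarrow> complex_differentiable_at f z"
  by (auto simp: complex_differentiable_at_def)

lemma complex_differentiable_at_imp_differentiable:
  "complex_differentiable_at f z \<Longrightarrow> f differentiable (at z)"
  by (auto simp: complex_differentiable_at_def differentiable_def)

section \<open>Rules of calculation for the Wirtinger operators\<close>

lemma d_z_has_derivative: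
  assumes "(f has_derivative L) (at z)"
  shows "d_z k f z = (L (axis k 1) - \<i> * L (axis k \<i>)) / 2"
  unfolding d_z_def frechet_derivative_at[OF assms, symmetric] ..

lemma d_zbar_has_derivative:
  assumes "(f has_derivative L) (at z)"
  shows "d_zbar k f z = (L (axis k 1) + \<i> * L (axis k \<i>)) / 2"
  unfolding d_zbar_def frechet_derivative_at[OF assms, symmetric] ..

lemma axis_imaginary_unit: "axis k \<i> = \<i> *s (axis k 1 :: complex ^ 'n::finite)"
  by (simp add: vec_eq_iff axis_def)

lemma d_z_complex_linear:
  fixes f :: "complex ^ 'n::finite \<Rightarrow> complex"
  assumes "(f has_derivative L) (at z)" "\<And>c v. L (c *s v) = c * L v"
  shows "d_z k f z = L (axis k 1)"
  using d_z_has_derivative[OF assms(1), of k] assms(2)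
  by (simp add: axis_imaginary_unit mult.assoc[symmetric])

text \<open>By complex linearity the derivative along \<open>axis k \<i>\<close> is \<i> times that
  along \<open>axis k 1\<close>, and \<i> squared cancels the two terms.\<close>

lemma d_zbar_complex_differentiable:
  assumes "complex_differentiable_at f z"
  shows "d_zbar k f z = 0"
  using assms by (auto simp: complex_differentiable_at_def d_zbar_has_derivative axis_imaginary_unit
      mult.assoc[symmetric])

lemma differentiable_cnj:
  "f differentiable (at z) \<Longrightarrow> (\<lambda>w. cnj (f w)) differentiable (at z)"
  unfolding differentiable_def using has_derivative_cnj by blast

lemma d_z_cnj:
  assumes "f differentiable (at z)"
  shows "d_z k (\<lambda>w. cnj (f w)) z = cnj (d_zbar k f z)"
proof -
  have D: "(f has_derivative frechet_derivative f (at z)) (at z)"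
    using assms by (simp add: frechet_derivative_works)
  show ?thesis
    by (simp add: d_z_has_derivative[OF has_derivative_cnj[OF D]] d_zbar_def)
qed

lemma d_zbar_cnj:
  assumes "f differentiable (at z)"
  shows "d_zbar k (\<lambda>w. cnj (f w)) z = cnj (d_z k f z)"
proof -
  have D: "(f has_derivative frechet_derivative f (at z)) (at z)"
    using assms by (simp add: frechet_derivative_works)
  show ?thesis
    by (simp add: d_zbar_has_derivative[OF has_derivative_cnj[OF D]] d_z_def)
qed

lemma
  assumes "f differentiable (at z)" "g differentiable (at z)"
  shows d_z_mult: "d_z k (\<lambda>w. f w * g w) z = f z * d_z k g z + d_z k f z * g z"
    and d_zbar_mult: "d_zbar k (\<lambda>w. f w * g w) z = f z * d_zbar k g z + d_zbar k f z * g z"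
proof -
  have D: "(f has_derivative frechet_derivative f (at z)) (at z)"
    "(g has_derivative frechet_derivative g (at z)) (at z)"
    using assms by (simp_all add: frechet_derivative_works)
  show "d_z k (\<lambda>w. f w * g w) z = f z * d_z k g z + d_z k f z * g z"
    unfolding d_z_has_derivative[OF has_derivative_mult[OF D]] D[THEN d_z_has_derivative] by (simp add: field_simps)
  show "d_zbar k (\<lambda>w. f w * g w) z = f z * d_zbar k g z + d_zbar k f z * g z"
    unfolding d_zbar_has_derivative[OF has_derivative_mult[OF D]] D[THEN d_zbar_has_derivative] by (simp add: field_simps)
qed

lemma
  assumes "\<And>i. i \<in> I \<Longrightarrow> f i differentiable (at z)"
  shows d_z_sum: "d_z k (\<lambda>w. \<Sum>i\<in>I. f i w) z = (\<Sum>i\<in>I. d_z k (f i) z)"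
    and d_zbar_sum: "d_zbar k (\<lambda>w. \<Sum>i\<in>I. f i w) z = (\<Sum>i\<in>I. d_zbar k (f i) z)"
proof -
  have "((\<lambda>w. \<Sum>i\<in>I. f i w) has_derivative (\<lambda>v. \<Sum>i\<in>I. frechet_derivative (f i) (at z) v)) (at z)"
    using assms by (intro has_derivative_sum) (simp add: frechet_derivative_works)
  note D = this
  show "d_z k (\<lambda>w. \<Sum>i\<in>I. f i w) z = (\<Sum>i\<in>I. d_z k (f i) z)"
    by (simp add: d_z_has_derivative[OF D], simp add: d_z_def sum_divide_distrib[symmetric] sum_subtractf sum_distrib_left)
  show "d_zbar k (\<lambda>w. \<Sum>i\<in>I. f i w) z = (\<Sum>i\<in>I. d_zbar k (f i) z)"
    by (simp add: d_zbar_has_derivative[OF D], simp add: d_zbar_def sum_divide_distrib[symmetric] sum.distrib sum_distrib_left)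
qed

lemma
  fixes u :: "complex ^ 'n::finite \<Rightarrow> real"
  assumes "u differentiable (at z)" "(\<phi> has_real_derivative c) (at (u z))"
  shows d_z_compose_real: "d_z k (\<lambda>w. complex_of_real (\<phi> (u w))) z = of_real c * d_z k (\<lambda>w. of_real (u w)) z"
    and d_zbar_compose_real: "d_zbar k (\<lambda>w. complex_of_real (\<phi> (u w))) z = of_real c * d_zbar k (\<lambda>w. of_real (u w)) z"
proof -
  have D: "(u has_derivative frechet_derivative u (at z)) (at z)"
    using assms by (simp add: frechet_derivative_works)
  note E = has_derivative_of_real[OF D, where 'a=complex]
  note F = has_derivative_of_real[OF DERIV_compose_FDERIV[OF assms(2) D], where 'a=complex]
  show "d_z k (\<lambda>w. complex_of_real (\<phi> (u w))) z = of_real c * d_z k (\<lambda>w. of_real (u w)) z"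
    unfolding d_z_has_derivative[OF E] d_z_has_derivative[OF F] by (simp add: field_simps)
  show "d_zbar k (\<lambda>w. complex_of_real (\<phi> (u w))) z = of_real c * d_zbar k (\<lambda>w. of_real (u w)) z"
    unfolding d_zbar_has_derivative[OF E] d_zbar_has_derivative[OF F] by (simp add: field_simps)
qed

text \<open>Needed for second derivatives: the first derivative is known by a formula only on an
  open set, and that formula is differentiated again.\<close>

lemma d_z_cong_open:
  assumes "open S" "z \<in> S" "\<And>w. w \<in> S \<Longrightarrow> f w = g w" "g differentiable (at z)"
  shows "d_z k f z = d_z k g z"
proof -
  have D: "(g has_derivative frechet_derivative g (at z)) (at z)"
    using assms by (simp add: frechet_derivative_works)
  then have "(f has_derivative frechet_derivative g (at z)) (at z)"
    by (rule has_derivative_transform_within_open[OF _ assms(1,2)]) (simp add: assms(3))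
  from d_z_has_derivative[OF this] show ?thesis by (simp add: d_z_def)
qed

lemma complex_differentiable_at_cong_open:
  assumes "open S" "z \<in> S" "\<And>w. w \<in> S \<Longrightarrow> f w = g w" "complex_differentiable_at g z"
  shows "complex_differentiable_at f z"
proof -
  obtain L where L: "(g has_derivative L) (at z)" "\<And>c v. L (c *s v) = c * L v"
    using assms(4) by (auto simp: complex_differentiable_at_def)
  from L(1) have "(f has_derivative L) (at z)"
    by (rule has_derivative_transform_within_open[OF _ assms(1,2)]) (simp add: assms(3))
  then show ?thesis using L(2) by (rule complex_differentiable_atI)
qed

lemma complex_differentiable_at_const: "complex_differentiable_at (\<lambda>w. c) z"
  by (rule complex_differentiable_atI[OF has_derivative_const]) simp

lemma complex_differentiable_at_mult:
  assumes "complex_differentiable_at f z" "complex_differentiable_at g z"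
  shows "complex_differentiable_at (\<lambda>w. f w * g w) z"
proof -
  obtain L M where L: "(f has_derivative L) (at z)" "\<And>c v. L (c *s v) = c * L v"
    and M: "(g has_derivative M) (at z)" "\<And>c v. M (c *s v) = c * M v"
    using assms by (auto simp: complex_differentiable_at_def)
  show ?thesis
    by (rule complex_differentiable_atI[OF has_derivative_mult[OF L(1) M(1)]])
      (simp add: L M algebra_simps)
qed

lemma complex_differentiable_at_add:
  assumes "complex_differentiable_at f z" "complex_differentiable_at g z"
  shows "complex_differentiable_at (\<lambda>w. f w + g w) z"
proof -
  obtain L M where L: "(f has_derivative L) (at z)" "\<And>c v. L (c *s v) = c * L v"
    and M: "(g has_derivative M) (at z)" "\<And>c v. M (c *s v) = c * M v"
    using assms by (auto simp: complex_differentiable_at_def)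
  show ?thesis
    by (rule complex_differentiable_atI[OF has_derivative_add[OF L(1) M(1)]])
      (simp add: L M algebra_simps)
qed

lemma complex_differentiable_at_sum:
  "(\<And>i. i \<in> I \<Longrightarrow> complex_differentiable_at (f i) z) \<Longrightarrow>
    complex_differentiable_at (\<lambda>w. \<Sum>i\<in>I. f i w) z"
  by (induction I rule: infinite_finite_induct)
    (auto intro: complex_differentiable_at_const complex_differentiable_at_add)

lemma has_derivative_inverse_complex:
  fixes f :: "complex ^ 'n::finite \<Rightarrow> complex"
  assumes "f z \<noteq> 0" "(f has_derivative L) (at z)"
  shows "((\<lambda>w. inverse (f w)) has_derivative (\<lambda>v. - (inverse (f z) * L v * inverse (f z)))) (at z)"
  using Deriv.has_derivative_inverse[of f z, OF assms] .

lemma complex_differentiable_at_inverse: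
  assumes "complex_differentiable_at f z" "f z \<noteq> 0"
  shows "complex_differentiable_at (\<lambda>w. inverse (f w)) z"
proof -
  obtain L where L: "(f has_derivative L) (at z)" "\<And>c v. L (c *s v) = c * L v"
    using assms by (auto simp: complex_differentiable_at_def)
  show ?thesis
    by (rule complex_differentiable_atI[OF has_derivative_inverse_complex[OF assms(2) L(1)]])
      (simp add: L)
qed

lemma d_z_inverse:
  assumes "complex_differentiable_at f z" "f z \<noteq> 0"
  shows "d_z k (\<lambda>w. inverse (f w)) z = - 1 * (inverse (f z) * d_z k f z * inverse (f z))"
proof -
  obtain L where L: "(f has_derivative L) (at z)" "\<And>c v. L (c *s v) = c * L v"
    using assms by (auto simp: complex_differentiable_at_def)
  show ?thesis
    using d_z_complex_linear[OF has_derivative_inverse_complex[OF assms(2) L(1)], of k]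
    by (simp add: L(2) d_z_complex_linear[OF L])
qed

section \<open>Affine forms and holomorphy to second order\<close>

lemma bounded_linear_linear_form:
  "bounded_linear (\<lambda>z :: complex ^ 'n::finite. \<Sum>k\<in>UNIV. A k * z $ k)"
  by (intro bounded_linear_sum bounded_linear_const_mult bounded_linear_vec_nth)

lemma has_derivative_affine_form:
  "((\<lambda>z :: complex ^ 'n::finite. c + (\<Sum>k\<in>UNIV. A k * z $ k)) has_derivative
     (\<lambda>v. \<Sum>k\<in>UNIV. A k * v $ k)) (at z)"
  using has_derivative_add[OF has_derivative_const[of c]
      bounded_linear_imp_has_derivative[OF bounded_linear_linear_form[of A]]] by simp

lemma
  fixes A :: "'n::finite \<Rightarrow> complex"
  shows complex_differentiable_at_affine_form:
      "complex_differentiable_at (\<lambda>z. c + (\<Sum>k\<in>UNIV. A k * z $ k)) z"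
    and d_z_affine_form: "d_z k (\<lambda>z. c + (\<Sum>k\<in>UNIV. A k * z $ k)) z = A k"
proof -
  have lin: "(\<Sum>k\<in>UNIV. A k * (b *s v) $ k) = b * (\<Sum>k\<in>UNIV. A k * v $ k)" for b v
    by (simp add: sum_distrib_left algebra_simps)
  show "complex_differentiable_at (\<lambda>z. c + (\<Sum>k\<in>UNIV. A k * z $ k)) z"
    by (rule complex_differentiable_atI[OF has_derivative_affine_form]) (rule lin)
  have "(\<Sum>l\<in>UNIV. A l * axis k 1 $ l) = (\<Sum>l\<in>UNIV. if l = k then A l else 0)"
    by (rule sum.cong) (auto simp: axis_def)
  then show "d_z k (\<lambda>z. c + (\<Sum>k\<in>UNIV. A k * z $ k)) z = A k"
    using d_z_complex_linear[OF has_derivative_affine_form lin, where k=k] by simp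
qed

text \<open>This is what the Levi form computation uses. Holomorphy on an open set would imply it,
  but stated separately it follows for affine forms, products and inverses from the differentiation
  rules alone.\<close>

definition twice_complex_differentiable_on ::
    "(complex ^ 'n::finite) set \<Rightarrow> (complex ^ 'n \<Rightarrow> complex) \<Rightarrow> bool" where
  "twice_complex_differentiable_on S f \<longleftrightarrow>
     (\<forall>z\<in>S. complex_differentiable_at f z \<and> (\<forall>k. complex_differentiable_at (d_z k f) z))"

lemma twice_complex_differentiable_onI:
  assumes "open S" "\<And>z. z \<in> S \<Longrightarrow> complex_differentiable_at f z"
    and "\<And>z k. z \<in> S \<Longrightarrow> d_z k f z = D k z"
    and "\<And>z k. z \<in> S \<Longrightarrow> complex_differentiable_at (D k) z"
  shows "twice_complex_differentiable_on S f"
  unfolding twice_complex_differentiable_on_def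
  using assms complex_differentiable_at_cong_open[OF assms(1), of _ "d_z k f" "D k" for k] by blast

lemma twice_complex_differentiable_on_affine_form:
  "open S \<Longrightarrow> twice_complex_differentiable_on S (\<lambda>z. c + (\<Sum>k\<in>UNIV. A k * z $ k))"
  by (rule twice_complex_differentiable_onI[OF _ complex_differentiable_at_affine_form
        d_z_affine_form complex_differentiable_at_const])

lemma twice_complex_differentiable_on_const:
  "open S \<Longrightarrow> twice_complex_differentiable_on S (\<lambda>z. c)"
  using twice_complex_differentiable_on_affine_form[of S c "\<lambda>k. 0"] by simp

lemma twice_complex_differentiable_on_mult:
  assumes "open S" "twice_complex_differentiable_on S f" "twice_complex_differentiable_on S g"
  shows "twice_complex_differentiable_on S (\<lambda>z. f z * g z)"
proof (rule twice_complex_differentiable_onI[OF assms(1)])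
  fix z k assume "z \<in> S"
  then have fg: "complex_differentiable_at f z" "complex_differentiable_at g z"
    "complex_differentiable_at (d_z k f) z" "complex_differentiable_at (d_z k g) z"
    using assms by (auto simp: twice_complex_differentiable_on_def)
  show "complex_differentiable_at (\<lambda>z. f z * g z) z"
    using fg by (intro complex_differentiable_at_mult)
  show "d_z k (\<lambda>z. f z * g z) z = f z * d_z k g z + d_z k f z * g z"
    using fg by (intro d_z_mult complex_differentiable_at_imp_differentiable)
  show "complex_differentiable_at (\<lambda>z. f z * d_z k g z + d_z k f z * g z) z"
    using fg by (intro complex_differentiable_at_mult complex_differentiable_at_add)
qed

lemma twice_complex_differentiable_on_inverse:
  assumes "open S" "twice_complex_differentiable_on S f" "\<And>z. z \<in> S \<Longrightarrow> f z \<noteq> 0"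
  shows "twice_complex_differentiable_on S (\<lambda>z. inverse (f z))"
proof (rule twice_complex_differentiable_onI[OF assms(1)])
  fix z k assume z: "z \<in> S"
  then have f: "complex_differentiable_at f z" "complex_differentiable_at (d_z k f) z"
    using assms by (auto simp: twice_complex_differentiable_on_def)
  show "complex_differentiable_at (\<lambda>z. inverse (f z)) z"
    using f(1) assms(3)[OF z] by (rule complex_differentiable_at_inverse)
  show "d_z k (\<lambda>z. inverse (f z)) z = - 1 * (inverse (f z) * d_z k f z * inverse (f z))"
    using f(1) assms(3)[OF z] by (rule d_z_inverse)
  show "complex_differentiable_at (\<lambda>z. - 1 * (inverse (f z) * d_z k f z * inverse (f z))) z"
    using f assms(3)[OF z]
    by (intro complex_differentiable_at_mult complex_differentiable_at_const
        complex_differentiable_at_inverse)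
qed

lemma twice_complex_differentiable_on_prod:
  assumes "open S" "\<And>i. i \<in> I \<Longrightarrow> twice_complex_differentiable_on S (f i)"
  shows "twice_complex_differentiable_on S (\<lambda>z. \<Prod>i\<in>I. f i z)"
  using assms(2)
  by (induction I rule: infinite_finite_induct)
    (auto intro: twice_complex_differentiable_on_const twice_complex_differentiable_on_mult assms(1))

section \<open>Functions of a sum of squared moduli of holomorphic functions\<close>

text \<open>Writing the squared modulus as Re (f * cnj f) avoids the norm, which is not
  differentiable at 0.\<close>

lemma differentiable_sum_norm_square:
  fixes f :: "'i \<Rightarrow> complex ^ 'n::finite \<Rightarrow> complex"
  assumes "\<And>i. i \<in> I \<Longrightarrow> f i differentiable (at z)"
  shows "(\<lambda>w. \<Sum>i\<in>I. (cmod (f i w))\<^sup>2) differentiable (at z)"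
proof -
  have "((\<lambda>w. Re (\<Sum>i\<in>I. f i w * cnj (f i w))) has_derivative
      (\<lambda>v. Re (\<Sum>i\<in>I. f i z * cnj (frechet_derivative (f i) (at z) v) +
        frechet_derivative (f i) (at z) v * cnj (f i z)))) (at z)"
    using assms
    by (intro has_derivative_Re has_derivative_sum has_derivative_mult has_derivative_cnj)
      (simp_all add: frechet_derivative_works)
  then have "(\<lambda>w. Re (\<Sum>i\<in>I. f i w * cnj (f i w))) differentiable (at z)"
    by (auto simp: differentiable_def)
  then show ?thesis
    by (simp only: complex_norm_square[symmetric] of_real_sum[symmetric] Re_complex_of_real)
qed

text \<open>Holomorphy kills d_zbar of \<open>f i\<close> and d_z of its conjugate, so one term of
  each product rule survives.\<close>

lemma
  fixes f :: "'i \<Rightarrow> complex ^ 'n::finite \<Rightarrow> complex"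
  assumes "\<And>i. i \<in> I \<Longrightarrow> complex_differentiable_at (f i) z"
  shows d_z_sum_norm_square: "d_z k (\<lambda>w. complex_of_real (\<Sum>i\<in>I. (cmod (f i w))\<^sup>2)) z =
      (\<Sum>i\<in>I. d_z k (f i) z * cnj (f i z))"
    and d_zbar_sum_norm_square: "d_zbar k (\<lambda>w. complex_of_real (\<Sum>i\<in>I. (cmod (f i w))\<^sup>2)) z =
      (\<Sum>i\<in>I. f i z * cnj (d_z k (f i) z))"
proof -
  have eq: "(\<lambda>w. complex_of_real (\<Sum>i\<in>I. (cmod (f i w))\<^sup>2)) = (\<lambda>w. \<Sum>i\<in>I. f i w * cnj (f i w))"
    by (simp only: of_real_sum complex_norm_square)
  have d: "f i differentiable (at z)" if "i \<in> I" for i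
    using assms that complex_differentiable_at_imp_differentiable by blast
  have p: "(\<lambda>w. f i w * cnj (f i w)) differentiable (at z)" if "i \<in> I" for i
    by (intro differentiable_mult differentiable_cnj d that)
  show "d_z k (\<lambda>w. complex_of_real (\<Sum>i\<in>I. (cmod (f i w))\<^sup>2)) z =
      (\<Sum>i\<in>I. d_z k (f i) z * cnj (f i z))"
    unfolding eq by (simp add: d_z_sum p d_z_mult d differentiable_cnj d_z_cnj
        d_zbar_complex_differentiable assms)
  show "d_zbar k (\<lambda>w. complex_of_real (\<Sum>i\<in>I. (cmod (f i w))\<^sup>2)) z =
      (\<Sum>i\<in>I. f i z * cnj (d_z k (f i) z))"
    unfolding eq by (simp add: d_zbar_sum p d_zbar_mult d differentiable_cnj d_zbar_cnj
        d_zbar_complex_differentiable assms)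
qed

text \<open>The chain rule splits the Levi form into a rank-one part from the differential of u and
  \<phi>' times the Levi form of u. For holomorphic \<open>f i\<close> the latter is the sum of the
  squared moduli of their differentials \<open>Q i v\<close>.\<close>

lemma levi_form_compose_sum_norm_square:
  fixes f :: "'i \<Rightarrow> complex ^ 'n::finite \<Rightarrow> complex"
  assumes S: "open S" "z \<in> S"
    and f: "\<And>i. i \<in> I \<Longrightarrow> twice_complex_differentiable_on S (f i)"
    and \<phi>: "\<And>t. (\<phi> has_real_derivative \<phi>' t) (at t)" "\<And>t. (\<phi>' has_real_derivative \<phi>'' t) (at t)"
  defines "u \<equiv> \<lambda>w. \<Sum>i\<in>I. (cmod (f i w))\<^sup>2"
    and "Q \<equiv> \<lambda>i v. \<Sum>k\<in>UNIV. d_z k (f i) z * v $ k"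
  shows "levi_form (\<lambda>w. \<phi> (u w)) z v =
    \<phi>'' (u z) * (cmod (\<Sum>i\<in>I. Q i v * cnj (f i z)))\<^sup>2 + \<phi>' (u z) * (\<Sum>i\<in>I. (cmod (Q i v))\<^sup>2)"
proof -
  have cd: "complex_differentiable_at (f i) w" "complex_differentiable_at (d_z k (f i)) w"
    if "i \<in> I" "w \<in> S" for i w k
    using f that by (auto simp: twice_complex_differentiable_on_def)
  note d = cd[THEN complex_differentiable_at_imp_differentiable]
  have du: "u differentiable (at w)" if "w \<in> S" for w
    unfolding u_def using d that by (intro differentiable_sum_norm_square) auto
  \<comment> \<open>\<open>X j\<close> is the d_z derivative of u at z in direction j,
    \<open>H k\<close> is the d_zbar derivative of u as a function on S, and \<open>Y j k\<close> is
    the mixed second derivative of u at z.\<close>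
  define X where "X = (\<lambda>j. \<Sum>i\<in>I. d_z j (f i) z * cnj (f i z))"
  define Y where "Y = (\<lambda>j k. \<Sum>i\<in>I. d_z j (f i) z * cnj (d_z k (f i) z))"
  define H where "H = (\<lambda>k w. \<Sum>i\<in>I. f i w * cnj (d_z k (f i) w))"
  have Hi: "(\<lambda>w. f i w * cnj (d_z k (f i) w)) differentiable (at z)" if "i \<in> I" for i k
    using d that S(2) by (intro differentiable_mult differentiable_cnj) auto
  then have dH: "H k differentiable (at z)" for k
    unfolding H_def
    by (cases "finite I") (auto intro!: differentiable_sum)
  have \<phi>'_diff: "(\<lambda>w. complex_of_real (\<phi>' (u w))) differentiable (at z)"
    using has_derivative_of_real[OF DERIV_compose_FDERIV[OF \<phi>(2)
          du[OF S(2), unfolded frechet_derivative_works]]]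
    by (rule differentiableI)
  have zbar: "d_zbar k (\<lambda>w. complex_of_real (\<phi> (u w))) w = of_real (\<phi>' (u w)) * H k w"
    if "w \<in> S" for k w
    using d_zbar_compose_real[OF du[OF that] \<phi>(1), of k] d_zbar_sum_norm_square[of I f w k] cd that
    by (simp add: H_def u_def)
  have dH_eq: "d_z j (H k) z = Y j k" for j k
    unfolding H_def Y_def using Hi d cd S(2)
    by (simp add: d_z_sum d_z_mult differentiable_cnj d_z_cnj d_zbar_complex_differentiable)
  have second: "d_z j (d_zbar k (\<lambda>w. complex_of_real (\<phi> (u w)))) z =
      of_real (\<phi>'' (u z)) * (X j * H k z) + of_real (\<phi>' (u z)) * Y j k" for j k
  proof -
    have "d_z j (d_zbar k (\<lambda>w. complex_of_real (\<phi> (u w)))) z =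
        d_z j (\<lambda>w. of_real (\<phi>' (u w)) * H k w) z"
      by (rule d_z_cong_open[OF S zbar]) (auto intro: differentiable_mult dH \<phi>'_diff)
    also have "\<dots> = of_real (\<phi>' (u z)) * d_z j (H k) z +
        d_z j (\<lambda>w. complex_of_real (\<phi>' (u w))) z * H k z"
      by (rule d_z_mult[OF \<phi>'_diff dH])
    also have "d_z j (\<lambda>w. complex_of_real (\<phi>' (u w))) z =
        of_real (\<phi>'' (u z)) * X j"
      using d_z_compose_real[OF du[OF S(2)] \<phi>(2), of j] d_z_sum_norm_square[of I f z j] cd S(2)
      by (simp add: u_def X_def)
    finally show ?thesis by (simp add: dH_eq algebra_simps)
  qed
  define P where "P = (\<Sum>i\<in>I. Q i v * cnj (f i z))"
  have P1: "P = (\<Sum>j\<in>UNIV. X j * v $ j)"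
    unfolding X_def P_def Q_def sum_distrib_right
    by (subst sum.swap) (intro sum.cong refl, simp add: mult_ac)
  \<comment> \<open>As u is real, \<open>H k z\<close> is the conjugate of
    \<open>X k\<close>.\<close>
  have P2: "cnj P = (\<Sum>k\<in>UNIV. H k z * cnj (v $ k))"
    unfolding P1 H_def X_def by (simp add: algebra_simps)
  have QQ: "(\<Sum>j\<in>UNIV. \<Sum>k\<in>UNIV. Y j k * v $ j * cnj (v $ k))
     = (\<Sum>i\<in>I. Q i v * cnj (Q i v))"
  proof -
    have "(\<Sum>j\<in>UNIV. \<Sum>k\<in>UNIV. Y j k * v $ j * cnj (v $ k))
      = (\<Sum>j\<in>UNIV. \<Sum>k\<in>UNIV. \<Sum>i\<in>I. (d_z j (f i) z * v $ j) * (cnj (d_z k (f i) z) * cnj (v $ k)))"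
      unfolding Y_def sum_distrib_right by (intro sum.cong refl) (simp add: mult_ac)
    also have "\<dots> = (\<Sum>j\<in>UNIV. \<Sum>i\<in>I. \<Sum>k\<in>UNIV. (d_z j (f i) z * v $ j) * (cnj (d_z k (f i) z) * cnj (v $ k)))"
      by (intro sum.cong refl sum.swap)
    also have "\<dots> = (\<Sum>i\<in>I. \<Sum>j\<in>UNIV. \<Sum>k\<in>UNIV. (d_z j (f i) z * v $ j) * (cnj (d_z k (f i) z) * cnj (v $ k)))"
      by (rule sum.swap)
    also have "\<dots> = (\<Sum>i\<in>I. Q i v * cnj (Q i v))"
      by (simp add: Q_def sum_product)
    finally show ?thesis .
  qed
  have "(\<Sum>j\<in>UNIV. \<Sum>k\<in>UNIV. d_z j (d_zbar k (\<lambda>w. complex_of_real (\<phi> (u w)))) z * v $ j * cnj (v $ k)) =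
     of_real (\<phi>'' (u z)) * (\<Sum>j\<in>UNIV. \<Sum>k\<in>UNIV. (X j * v $ j) * (H k z * cnj (v $ k)))
     + of_real (\<phi>' (u z)) * (\<Sum>j\<in>UNIV. \<Sum>k\<in>UNIV. Y j k * v $ j * cnj (v $ k))"
    unfolding second sum_distrib_left sum.distrib[symmetric]
    by (intro sum.cong refl) (simp add: algebra_simps)
  also have "\<dots> = of_real (\<phi>'' (u z)) * (P * cnj P) + of_real (\<phi>' (u z)) * (\<Sum>i\<in>I. Q i v * cnj (Q i v))"
    unfolding QQ P2 unfolding P1 by (simp only: sum_product)
  also have "\<dots> = complex_of_real (\<phi>'' (u z) * (cmod P)\<^sup>2 + \<phi>' (u z) * (\<Sum>i\<in>I. (cmod (Q i v))\<^sup>2))"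
    by (simp only: of_real_add of_real_mult of_real_sum complex_norm_square)
  finally show ?thesis
    unfolding levi_form_def P_def by simp
qed

lemma levi_form_norm_square: "levi_form (\<lambda>w. (norm w)\<^sup>2) z v = (norm (v :: complex ^ 'n::finite))\<^sup>2"
proof -
  \<comment> \<open>The coordinate functions are written as affine forms, so that the previous lemma
    applies with \<phi> the identity.\<close>
  define f :: "'n \<Rightarrow> complex ^ 'n \<Rightarrow> complex"
    where "f = (\<lambda>i w. 0 + (\<Sum>k\<in>UNIV. (if k = i then 1 else 0) * w $ k))"
  have fw: "f i w = w $ i" for i w
  proof -
    have "(\<Sum>k\<in>UNIV. (if k = i then 1 else 0) * w $ k) = (\<Sum>k\<in>UNIV. if k = i then w $ k else 0)"
      by (rule sum.cong) auto
    then show ?thesis by (simp add: f_def)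
  qed
  have n: "(norm w)\<^sup>2 = (\<Sum>i\<in>UNIV. (cmod (w $ i))\<^sup>2)" for w :: "complex ^ 'n"
    by (simp add: norm_vec_def L2_set_def sum_nonneg)
  have "twice_complex_differentiable_on UNIV (f i)" for i
    unfolding f_def by (rule twice_complex_differentiable_on_affine_form) simp
  then have "levi_form (\<lambda>w. \<Sum>i\<in>UNIV. (cmod (f i w))\<^sup>2) z v =
      (\<Sum>i\<in>UNIV. (cmod (\<Sum>k\<in>UNIV. d_z k (f i) z * v $ k))\<^sup>2)"
    using levi_form_compose_sum_norm_square[of UNIV z UNIV f "\<lambda>t. t" "\<lambda>t. 1" "\<lambda>t. 0" v] by simp
  moreover have "(\<Sum>k\<in>UNIV. d_z k (f i) z * v $ k) = v $ i" for i
    using fw[of i v] unfolding f_def d_z_affine_form by simp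
  ultimately show ?thesis by (simp add: fw n)
qed

section \<open>Circle averages and the sub-mean value inequality\<close>

lemma bounded_linear_complex_scale: "bounded_linear (\<lambda>h. h *s (w :: complex ^ 'n::finite))"
  unfolding linear_conv_bounded_linear[symmetric]
  by (rule linearI) (simp_all add: vec_eq_iff algebra_simps)

text \<open>On the complex line through z in direction w this is Cauchy's integral formula at the
  centre of the disc.\<close>

lemma circle_mean_value:
  fixes G :: "complex ^ 'n::finite \<Rightarrow> complex"
  assumes "\<And>\<zeta>. cmod \<zeta> \<le> 1 \<Longrightarrow> complex_differentiable_at G (z + \<zeta> *s w)"
  shows "((\<lambda>\<theta>. G (z + cis \<theta> *s w)) has_integral 2 * pi * G z) {0..2 * pi}"
proof -
  define g where "g = (\<lambda>\<zeta>. G (z + \<zeta> *s w))"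
  have fd: "g field_differentiable (at \<zeta>)" if \<zeta>: "cmod \<zeta> \<le> 1" for \<zeta>
  proof -
    obtain L where L: "(G has_derivative L) (at (z + \<zeta> *s w))" "\<And>c v. L (c *s v) = c * L v"
      using assms[OF \<zeta>] by (auto simp: complex_differentiable_at_def)
    have "((\<lambda>\<zeta>. z + \<zeta> *s w) has_derivative (\<lambda>h. h *s w)) (at \<zeta>)"
      using has_derivative_add[OF has_derivative_const bounded_linear_imp_has_derivative[OF
            bounded_linear_complex_scale], of z]
      by simp
    from has_derivative_compose[OF this L(1)] have "(g has_derivative (\<lambda>h. h * L w)) (at \<zeta>)"
      by (simp add: g_def L(2))
    then show ?thesis
      by (auto simp: field_differentiable_def has_field_derivative_def mult.commute[of _ "L w"] intro!: exI[of _ "L w"])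
  qed
  have "g holomorphic_on cball 0 1"
    by (auto simp: holomorphic_on_def intro!: field_differentiable_at_within fd)
  then have "((\<lambda>u. g u / (u - 0)) has_contour_integral (2 * of_real pi * \<i> * g 0)) (circlepath 0 1)"
    by (intro Cauchy_integral_circlepath holomorphic_on_imp_continuous_on)
      (auto intro: holomorphic_on_subset)
  \<comment> \<open>In the parametrised integral the Cauchy kernel cancels the factor
    \<open>cis t\<close> of the velocity, leaving only \<i>.\<close>
  then have "((\<lambda>t. g (0 + 1 * cis t) / (0 + 1 * cis t - 0) * 1 * \<i> * cis t) has_integral
      (2 * of_real pi * \<i> * g 0)) {0..2*pi}"
    unfolding circlepath_def by (subst (asm) has_contour_integral_part_circlepath_iff) auto
  then have "((\<lambda>t. g (cis t) * \<i>) has_integral (2 * of_real pi * \<i> * g 0)) {0..2*pi}"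
    by simp
  then have "((\<lambda>t. g (cis t) * \<i> * (- \<i>)) has_integral (2 * of_real pi * \<i> * g 0 * (- \<i>))) {0..2*pi}"
    by (rule has_integral_mult_left)
  then show ?thesis by (simp add: g_def algebra_simps)
qed

lemma norm_square_above_tangent:
  "2 * Re (cnj y * (x - y)) \<le> (cmod x)\<^sup>2 - (cmod y)\<^sup>2"
proof -
  have "(cmod x)\<^sup>2 - (cmod y)\<^sup>2 - 2 * Re (cnj y * (x - y)) = (cmod (x - y))\<^sup>2"
    unfolding cmod_power2 by (simp add: power2_eq_square algebra_simps)
  then show ?thesis using zero_le_power2[of "cmod (x - y)"] by linarith
qed

text \<open>
  The tangent line of \<open>\<phi>\<close> and those of the squared moduli give a pluriharmonic minorant
  touching the function at the centre of the disc.
\<close>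

lemma plurisubharmonic_on_compose_sum_norm_square:
  fixes f :: "'i \<Rightarrow> complex ^ 'n::finite \<Rightarrow> complex"
  assumes f: "\<And>i z. i \<in> I \<Longrightarrow> z \<in> S \<Longrightarrow> complex_differentiable_at (f i) z"
    and \<phi>: "\<And>t. (\<phi> has_real_derivative \<phi>' t) (at t)" "\<And>s t. \<phi> s + \<phi>' s * (t - s) \<le> \<phi> t"
      "\<And>t. \<phi>' t \<ge> 0"
  defines "u \<equiv> \<lambda>w. \<Sum>i\<in>I. (cmod (f i w))\<^sup>2"
  shows "plurisubharmonic_on S (\<lambda>w. \<phi> (u w))"
proof -
  have cu: "continuous (at z) u" if "z \<in> S" for z
    unfolding u_def using f that complex_differentiable_at_imp_differentiable
    by (intro differentiable_imp_continuous_within differentiable_sum_norm_square) auto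
  have cF: "continuous_on S (\<lambda>w. \<phi> (u w))"
    by (intro continuous_at_imp_continuous_on ballI isCont_o2[OF cu DERIV_isCont[OF \<phi>(1)]])
  have "upper_semicontinuous_on S (\<lambda>w. \<phi> (u w))"
    using cF unfolding upper_semicontinuous_on_def continuous_on_def
    by (auto dest: order_tendstoD(2))
  moreover have "(\<lambda>\<theta>. \<phi> (u (z + cis \<theta> *s w))) absolutely_integrable_on {0..2 * pi} \<and>
        \<phi> (u z) \<le> 1 / (2 * pi) * integral {0..2 * pi} (\<lambda>\<theta>. \<phi> (u (z + cis \<theta> *s w)))"
    if disc: "\<forall>\<zeta>::complex. norm \<zeta> \<le> 1 \<longrightarrow> z + \<zeta> *s w \<in> S" for z w
  proof -
    \<comment> \<open>\<open>G\<close> is holomorphic, and up to an additive constant its real part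
      is the minorant; 2 * cnj (f i z) is the slope of the squared modulus and \<phi>' (u z) that of
      \<phi>.\<close>
    define G where "G = (\<lambda>x. \<Sum>i\<in>I. (2 * of_real (\<phi>' (u z)) * cnj (f i z)) * f i x)"
    have "complex_differentiable_at G (z + \<zeta> *s w)" if "cmod \<zeta> \<le> 1" for \<zeta>
      unfolding G_def using f disc that
      by (intro complex_differentiable_at_sum complex_differentiable_at_mult
          complex_differentiable_at_const) auto
    then have "((\<lambda>\<theta>. G (z + cis \<theta> *s w)) has_integral 2 * pi * G z) {0..2 * pi}"
      by (rule circle_mean_value)
    then have "((\<lambda>\<theta>. Re (G (z + cis \<theta> *s w))) has_integral Re (2 * pi * G z)) {0..2 * pi}"
      by (rule has_integral_Re)
    moreover have "((\<lambda>\<theta>. \<phi> (u z) - Re (G z)) has_integral (2 * pi) *\<^sub>R (\<phi> (u z) - Re (G z))) {0..2 * pi}"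
      using has_integral_const_real[of "\<phi> (u z) - Re (G z)" 0 "2 * pi"] by simp
    ultimately have low: "((\<lambda>\<theta>. (\<phi> (u z) - Re (G z)) + Re (G (z + cis \<theta> *s w))) has_integral
        (2 * pi) *\<^sub>R (\<phi> (u z) - Re (G z)) + Re (2 * pi * G z)) {0..2 * pi}"
      by (intro has_integral_add)
    have touch: "\<phi> (u z) - Re (G z) + Re (G x) \<le> \<phi> (u x)" for x
    proof -
      have "u x - u z \<ge> (\<Sum>i\<in>I. 2 * Re (cnj (f i z) * (f i x - f i z)))"
        unfolding u_def sum_subtractf[symmetric] by (intro sum_mono norm_square_above_tangent)
      then have "\<phi>' (u z) * (u x - u z) \<ge> \<phi>' (u z) * (\<Sum>i\<in>I. 2 * Re (cnj (f i z) * (f i x - f i z)))"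
        using \<phi>(3) by (rule mult_left_mono)
      also have "\<phi>' (u z) * (\<Sum>i\<in>I. 2 * Re (cnj (f i z) * (f i x - f i z))) = Re (G x) - Re (G z)"
        unfolding G_def Re_sum sum_subtractf[symmetric] sum_distrib_left
        by (intro sum.cong refl) (simp add: algebra_simps)
      finally show ?thesis using \<phi>(2)[of "u z" "u x"] by linarith
    qed
    have "continuous_on {0..2 * pi} (\<lambda>\<theta>. z + cis \<theta> *s w)"
      by (intro continuous_intros bounded_linear.continuous_on[OF bounded_linear_complex_scale])
    then have ai: "(\<lambda>\<theta>. \<phi> (u (z + cis \<theta> *s w))) absolutely_integrable_on {0..2 * pi}"
      using disc by (intro absolutely_integrable_continuous_real continuous_on_compose2[OF cF]) auto
    then have "(\<lambda>\<theta>. \<phi> (u (z + cis \<theta> *s w))) integrable_on {0..2 * pi}"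
      using absolutely_integrable_on_def by blast
    then have "(2 * pi) *\<^sub>R (\<phi> (u z) - Re (G z)) + Re (2 * pi * G z)
        \<le> integral {0..2 * pi} (\<lambda>\<theta>. \<phi> (u (z + cis \<theta> *s w)))"
      using touch by (intro has_integral_le[OF low integrable_integral]) auto
    then have "2 * pi * \<phi> (u z) \<le> integral {0..2 * pi} (\<lambda>\<theta>. \<phi> (u (z + cis \<theta> *s w)))"
      by (simp add: algebra_simps)
    with ai show ?thesis by (simp add: field_simps)
  qed
  ultimately show ?thesis
    unfolding plurisubharmonic_on_def by blast
qed

section \<open>Supporting forms of domains in the normalised class\<close>

text \<open>Turns a real separating functional into the real part of a complex linear form with
  conjugated coefficients.\<close>

lemma inner_complex_vec: "a \<bullet> (z :: complex ^ 'n::finite) = Re (\<Sum>k\<in>UNIV. cnj (a $ k) * z $ k)"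
  by (simp add: inner_vec_def inner_complex_def)

lemma inner_less_of_open:
  fixes a :: "'a::real_inner"
  assumes "open S" "a \<noteq> 0" "\<And>x. x \<in> S \<Longrightarrow> a \<bullet> x \<le> b" "x \<in> S"
  shows "a \<bullet> x < b"
proof -
  obtain e where e: "e > 0" "ball x e \<subseteq> S"
    using assms(1,4) open_contains_ball by blast
  \<comment> \<open>A step of length e/2 along a stays in S and strictly increases the
    functional.\<close>
  have "x + (e / 2 / norm a) *\<^sub>R a \<in> ball x e"
    using e(1) assms(2) by (simp add: dist_norm)
  then have "a \<bullet> (x + (e / 2 / norm a) *\<^sub>R a) \<le> b"
    using assms(3) e(2) by blast
  moreover have "a \<bullet> (x + (e / 2 / norm a) *\<^sub>R a) > a \<bullet> x"
    using e(1) assms(2) by (simp add: inner_add_right)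
  ultimately show ?thesis by linarith
qed

lemma convex_complex_span: "convex (vec.span (B :: (complex ^ 'n::finite) set))"
proof (rule convexI)
  fix x y :: "complex ^ 'n" and s t :: real
  assume "x \<in> vec.span B" "y \<in> vec.span B"
  then have "complex_of_real s *s x + complex_of_real t *s y \<in> vec.span B"
    by (intro vec.span_add vec.span_scale)
  moreover have "complex_of_real c *s w = c *\<^sub>R w" for c and w :: "complex ^ 'n"
    by (simp add: vec_eq_iff complex_eq_iff)
  ultimately show "s *\<^sub>R x + t *\<^sub>R y \<in> vec.span B" by simp
qed

lemma inner_std_basis: "a \<bullet> (t *s std_basis k) = Re (cnj (a $ k) * t)"
proof -
  have "(\<Sum>l\<in>UNIV. cnj (a $ l) * (t *s std_basis k) $ l) = (\<Sum>l\<in>UNIV. if l = k then cnj (a $ l) * t else 0)"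
    by (intro sum.cong) (auto simp: std_basis_def axis_def)
  then show ?thesis by (simp add: inner_complex_vec)
qed

lemma norm_std_basis: "norm (std_basis k) = 1"
  using inner_std_basis[of "std_basis k" 1 k] by (simp add: norm_eq_sqrt_inner std_basis_def)

text \<open>A hyperplane separates \<Omega> from the affine subspace at the j-th basis vector. A
  functional bounded below on a complex affine subspace vanishes on its directions, whence the
  triangular shape; the discs of radius r on the axes bound the coefficients.\<close>

lemma K_class_supporting_form:
  fixes \<Omega> :: "(complex ^ 'n::{finite,linorder}) set"
  assumes "\<Omega> \<in> K_class r" "0 < r" "r \<le> 1"
  shows "\<exists>A :: 'n \<Rightarrow> complex. (\<forall>z\<in>\<Omega>. Re (\<Sum>k\<in>UNIV. A k * z $ k) < 1) \<and>
    (\<forall>k. j < k \<longrightarrow> A k = 0) \<and> cmod (A j) \<ge> 1 \<and> (\<forall>k. cmod (A k) \<le> 1 / r)"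
proof -
  have \<Omega>: "open \<Omega>" "\<Omega> \<noteq> {}" "convex \<Omega>"
    and disc: "\<And>k \<zeta>. cmod \<zeta> < r \<Longrightarrow> \<zeta> *s std_basis k \<in> \<Omega>"
    and disj: "(\<lambda>v. std_basis j + v) ` vec.span {std_basis k |k. j < k} \<inter> \<Omega> = {}"
    using assms by (auto simp: K_class_def C_properly_convex_def) (metis less_le_trans)
  define T where "T = (\<lambda>v. std_basis j + v) ` vec.span {std_basis k |k. j < k}"
  have "convex T"
    unfolding T_def by (intro convex_translation convex_complex_span)
  moreover have "std_basis j + 0 \<in> T"
    unfolding T_def by (intro imageI vec.span_zero)
  ultimately obtain a b where a: "a \<noteq> 0" "\<And>x. x \<in> \<Omega> \<Longrightarrow> a \<bullet> x \<le> b" "\<And>x. x \<in> T \<Longrightarrow> a \<bullet> x \<ge> b"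
    using separating_hyperplane_sets[OF \<Omega>(3), of T] \<Omega>(2) disj unfolding T_def by blast
  have less: "a \<bullet> x < b" if "x \<in> \<Omega>" for x
    using inner_less_of_open[OF \<Omega>(1) a(1,2) that] .
  have b: "b > 0"
    using less[OF disc[of 0 j]] assms(2) by simp
  define c where "c = Re (a $ j)"
  have ac: "a \<bullet> std_basis j = c"
    using inner_std_basis[of a 1 j] by (simp add: c_def)
  then have c: "c \<ge> b"
    using a(3)[OF \<open>std_basis j + 0 \<in> T\<close>] by simp
  have zero: "a $ k = 0" if "j < k" for k
  proof (rule ccontr)
    assume ak: "a $ k \<noteq> 0"
    \<comment> \<open>Moving from the j-th basis vector by - s * a $ k in direction k lowers the
      functional from c to 0, below its bound b > 0 on T.\<close>
    define s where "s = c / (cmod (a $ k))\<^sup>2"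
    have "(- of_real s * a $ k) *s std_basis k \<in> vec.span {std_basis k |k. j < k}"
      using that by (intro vec.span_scale vec.span_base) auto
    then have "std_basis j + (- of_real s * a $ k) *s std_basis k \<in> T"
      unfolding T_def by blast
    from a(3)[OF this] have "b \<le> c + Re (cnj (a $ k) * (- of_real s * a $ k))"
      by (simp only: inner_add_right inner_std_basis ac)
    also have "cnj (a $ k) * (- of_real s * a $ k) = - of_real (s * (cmod (a $ k))\<^sup>2)"
      by (simp only: of_real_mult complex_norm_square) (simp add: algebra_simps)
    also have "s * (cmod (a $ k))\<^sup>2 = c"
      using ak by (simp add: s_def)
    finally show False using b by simp
  qed
  \<comment> \<open>Dividing by c >= b turns the bound b on \<Omega> into 1 and gives
    \<open>A j\<close> real part 1.\<close>
  define A where "A = (\<lambda>k. cnj (a $ k) / of_real c)"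
  have cpos: "c > 0" using b c by simp
  have form: "Re (\<Sum>k\<in>UNIV. A k * z $ k) = (a \<bullet> z) / c" for z
    by (simp add: A_def inner_complex_vec sum_divide_distrib[symmetric] flip: Re_divide_of_real)
  have half: "Re (\<Sum>k\<in>UNIV. A k * z $ k) < 1" if "z \<in> \<Omega>" for z
    unfolding form using less[OF that] c cpos by simp
  have bound: "cmod (A k) \<le> 1 / r" for k
  proof (rule ccontr)
    assume "\<not> cmod (A k) \<le> 1 / r"
    then have big: "cmod (A k) > 1 / r" by simp
    then have nz: "A k \<noteq> 0" using assms(2) by (auto simp: field_simps)
    \<comment> \<open>The point with k-th coordinate 1 / A k and all others 0 would lie in \<Omega>,
      although the form takes the value 1 there.\<close>
    have "cmod (1 / A k) < r"
      using big assms(2) nz by (simp add: norm_divide field_simps)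
    from half[OF disc[OF this, of k]] have "(a \<bullet> ((1 / A k) *s std_basis k)) / c < 1"
      by (simp only: form)
    moreover have "(a \<bullet> (t *s std_basis k)) / c = Re (A k * t)" for t
      by (simp only: inner_std_basis Re_divide_of_real[symmetric] A_def times_divide_eq_left)
    ultimately show False using nz by simp
  qed
  have "Re (A j) = 1"
    using cpos by (simp add: A_def c_def)
  then have "cmod (A j) \<ge> 1"
    using complex_Re_le_cmod[of "A j"] by simp
  with half bound zero show ?thesis
    by (intro exI[of _ A]) (auto simp: A_def)
qed

text \<open>Forward substitution: row j expresses its coordinate through the earlier ones, and each
  step costs at most a factor 1 + CARD('n) * R.\<close>

lemma triangular_system_bound:
  fixes A :: "'n::{finite,linorder} \<Rightarrow> 'n \<Rightarrow> complex" and z :: "complex ^ 'n::{finite,linorder}"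
  assumes zero: "\<And>j k. j < k \<Longrightarrow> A j k = 0" and diag: "\<And>j. cmod (A j j) \<ge> 1"
    and R: "\<And>j k. cmod (A j k) \<le> R" and T: "\<And>j. cmod (\<Sum>k\<in>UNIV. A j k * z $ k) \<le> T"
  shows "norm z \<le> real CARD('n) * (1 + real CARD('n) * R) ^ CARD('n) * T"
proof -
  define K where "K = 1 + real CARD('n) * R"
  \<comment> \<open>The rank of an index in the linear order, which serves as the induction
    measure.\<close>
  define N where "N = (\<lambda>j::'n. card {k. k < j})"
  have R0: "R \<ge> 0" and T0: "T \<ge> 0"
    using R[of undefined undefined] T[of undefined] norm_ge_zero order_trans by blast+
  have K1: "K \<ge> 1" using R0 by (simp add: K_def)
  have claim: "cmod (z $ j) \<le> T * K ^ N j" for j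
  proof (induction "N j" arbitrary: j rule: less_induct)
    case less
    have split: "(\<Sum>k\<in>UNIV. A j k * z $ k) = A j j * z $ j + (\<Sum>k\<in>{k. k < j}. A j k * z $ k)"
    proof -
      have "(\<Sum>k\<in>UNIV. A j k * z $ k) = (\<Sum>k\<in>insert j {k. k < j}. A j k * z $ k)"
        by (rule sum.mono_neutral_right) (auto simp: zero)
      then show ?thesis by simp
    qed
    have "cmod (z $ j) \<le> cmod (A j j * z $ j)"
      using mult_right_mono[OF diag[of j] norm_ge_zero[of "z $ j"]] by (simp add: norm_mult)
    also have "\<dots> \<le> cmod (\<Sum>k\<in>UNIV. A j k * z $ k) + cmod (\<Sum>k\<in>{k. k < j}. A j k * z $ k)"
      unfolding split by (metis add_diff_cancel_right' norm_triangle_ineq4)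
    also have "\<dots> \<le> T + (\<Sum>k\<in>{k. k < j}. R * (T * K ^ (N j - 1)))"
    proof (intro add_mono T sum_norm_le)
      fix k assume "k \<in> {k. k < j}"
      then have "k < j" by simp
      then have "{l. l < k} \<subset> {l. l < j}" by auto
      then have lt: "N k < N j" unfolding N_def by (intro psubset_card_mono) auto
      have "cmod (z $ k) \<le> T * K ^ N k" using less[OF lt] .
      also have "\<dots> \<le> T * K ^ (N j - 1)"
        using lt K1 T0 by (intro mult_left_mono power_increasing) auto
      finally show "cmod (A j k * z $ k) \<le> R * (T * K ^ (N j - 1))"
        unfolding norm_mult using R R0 by (intro mult_mono) auto
    qed
    also have "\<dots> = T + real (N j) * (R * (T * K ^ (N j - 1)))"
      by (simp add: N_def)
    also have "\<dots> \<le> T * K ^ N j"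
    \<comment> \<open>For \<open>N j = 0\<close> the sum is empty, so the truncated exponent
      \<open>N j - 1\<close> does no harm; otherwise the summand T is absorbed using T <= T *
      K^m.\<close>
    proof (cases "N j")
      case (Suc m)
      have "N j \<le> CARD('n)"
        unfolding N_def by (rule card_mono) auto
      then have "real (N j) * (R * (T * K ^ m)) \<le> real CARD('n) * (R * (T * K ^ m))"
        using R0 T0 K1 by (intro mult_right_mono) auto
      moreover have "T * 1 \<le> T * K ^ m"
        using K1 T0 by (intro mult_left_mono one_le_power)
      ultimately show ?thesis
        using Suc by (simp add: K_def algebra_simps)
    qed simp
    finally show ?case .
  qed
  have "norm z \<le> (\<Sum>j\<in>UNIV. cmod (z $ j))"
    by (simp add: norm_vec_def L2_set_le_sum)
  also have "\<dots> \<le> (\<Sum>j\<in>(UNIV::'n set). T * K ^ CARD('n))"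
  proof (rule sum_mono)
    fix j :: 'n
    have "N j \<le> CARD('n)"
      unfolding N_def by (rule card_mono) auto
    then show "cmod (z $ j) \<le> T * K ^ CARD('n)"
      using claim[of j] K1 T0
      by (meson mult_left_mono order_trans power_increasing)
  qed
  finally show ?thesis by (simp add: K_def algebra_simps)
qed

section \<open>The strictly plurisubharmonic function\<close>

text \<open>
  The functions \<open>f None = h\<close> and \<open>f (Some i) = h g\<^sub>i\<close> immerse the domain: their differentials
  determine the \<open>dg\<^sub>i\<close> because \<open>h\<close> has no zeros.
\<close>

locale half_space_domain =
  fixes S :: "(complex ^ 'n::finite) set" and A :: "'n \<Rightarrow> 'n \<Rightarrow> complex"
  assumes open_S: "open S"
    and Re_form_less: "z \<in> S \<Longrightarrow> Re (\<Sum>k\<in>UNIV. A j k * z $ k) < 1"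
begin

text \<open>With the constant 2 the real part exceeds 1 on S, so the inverse is bounded by 1 up to
  the boundary. The sign sits in the coefficients to match the lemmas on affine forms.\<close>

definition q :: "'n \<Rightarrow> complex ^ 'n \<Rightarrow> complex" where
  "q j z = 2 + (\<Sum>k\<in>UNIV. - A j k * z $ k)"

definition g :: "'n \<Rightarrow> complex ^ 'n \<Rightarrow> complex" where
  "g j z = inverse (q j z)"

definition h :: "complex ^ 'n \<Rightarrow> complex" where
  "h z = (\<Prod>j\<in>UNIV. g j z)"

definition f :: "'n option \<Rightarrow> complex ^ 'n \<Rightarrow> complex" where
  "f m z = h z * (case m of None \<Rightarrow> 1 | Some i \<Rightarrow> g i z)"

definition u :: "complex ^ 'n \<Rightarrow> real" where
  "u z = (\<Sum>m\<in>UNIV. (cmod (f m z))\<^sup>2)"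

lemma q_eq: "q j z = 2 - (\<Sum>k\<in>UNIV. A j k * z $ k)"
  by (simp add: q_def sum_negf)

lemma norm_q_ge_1: "z \<in> S \<Longrightarrow> 1 \<le> cmod (q j z)"
  using Re_form_less[of z j] complex_Re_le_cmod[of "q j z"] by (simp add: q_eq)

lemma q_nonzero: "z \<in> S \<Longrightarrow> q j z \<noteq> 0"
  using norm_q_ge_1[of z j] by auto

lemma norm_g_le_1: "z \<in> S \<Longrightarrow> cmod (g j z) \<le> 1"
  using norm_q_ge_1[of z j] by (simp add: g_def norm_inverse inverse_le_1_iff)

lemma norm_h_le_norm_g: "z \<in> S \<Longrightarrow> cmod (h z) \<le> cmod (g j z)"
proof -
  assume z: "z \<in> S"
  have "cmod (h z) = cmod (g j z) * (\<Prod>i\<in>UNIV - {j}. cmod (g i z))"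
    by (simp add: h_def prod.remove[of UNIV j] norm_mult prod_norm)
  also have "\<dots> \<le> cmod (g j z) * 1"
    using norm_g_le_1[OF z] by (intro mult_left_mono prod_le_1) auto
  finally show ?thesis by simp
qed

lemma u_eq: "u z = (cmod (h z))\<^sup>2 * (1 + (\<Sum>i\<in>UNIV. (cmod (g i z))\<^sup>2))"
  by (simp add: u_def f_def UNIV_option_conv sum.reindex norm_mult power_mult_distrib
      sum_distrib_left distrib_left)

text \<open>A single large \<open>q j z\<close> makes u small; this is what confines the superlevel
  sets of u to bounded sets.\<close>

lemma u_le: "z \<in> S \<Longrightarrow> u z \<le> (cmod (g j z))\<^sup>2 * (1 + real CARD('n))"
proof -
  assume z: "z \<in> S"
  have "(\<Sum>i\<in>UNIV. (cmod (g i z))\<^sup>2) \<le> (\<Sum>i\<in>(UNIV::'n set). 1)"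
    using norm_g_le_1[OF z] by (intro sum_mono) (simp add: power_le_one)
  then show ?thesis
    unfolding u_eq using norm_h_le_norm_g[OF z]
    by (intro mult_mono power_mono add_nonneg_nonneg sum_nonneg) auto
qed

lemma u_le_const: "z \<in> S \<Longrightarrow> u z \<le> 1 + real CARD('n)"
proof -
  assume z: "z \<in> S"
  have "(cmod (g undefined z))\<^sup>2 * (1 + real CARD('n)) \<le> 1 * (1 + real CARD('n))"
    using norm_g_le_1[OF z] by (intro mult_right_mono) (auto simp: power_le_one)
  from order_trans[OF u_le[OF z] this] show ?thesis by simp
qed

lemma norm_g_ge:
  assumes "z \<in> S" "cmod (q j z) \<le> B"
  shows "1 / B \<le> cmod (g j z)"
proof -
  have "inverse B \<le> inverse (cmod (q j z))"
    using norm_q_ge_1[OF assms(1), of j] by (intro le_imp_inverse_le[OF assms(2)]) linarith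
  then show ?thesis by (simp add: g_def norm_inverse divide_inverse)
qed

lemma norm_h_ge:
  assumes "z \<in> S" "B > 0" "\<And>j. cmod (q j z) \<le> B"
  shows "(1 / B) ^ CARD('n) \<le> cmod (h z)"
proof -
  have "(\<Prod>j\<in>(UNIV::'n set). 1 / B) \<le> (\<Prod>j\<in>UNIV. cmod (g j z))"
    using assms norm_g_ge by (intro prod_mono) auto
  then show ?thesis by (simp add: h_def prod_norm)
qed

lemma u_ge:
  assumes "z \<in> S" "B > 0" "\<And>j. cmod (q j z) \<le> B"
  shows "((1 / B) ^ CARD('n))\<^sup>2 \<le> u z"
proof -
  have "((1 / B) ^ CARD('n))\<^sup>2 \<le> (cmod (h z))\<^sup>2"
    using norm_h_ge[OF assms] assms(2) by (intro power_mono) auto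
  also have "\<dots> \<le> (cmod (h z))\<^sup>2 * (1 + (\<Sum>i\<in>UNIV. (cmod (g i z))\<^sup>2))"
    by (simp add: distrib_left sum_nonneg)
  finally show ?thesis by (simp add: u_eq)
qed

section \<open>Holomorphy of the functions and bounds on their differentials\<close>

lemma twice_complex_differentiable_on_g: "twice_complex_differentiable_on S (g j)"
  unfolding g_def[abs_def]
proof (rule twice_complex_differentiable_on_inverse[OF open_S _ q_nonzero])
  show "twice_complex_differentiable_on S (q j)"
    unfolding q_def[abs_def] by (rule twice_complex_differentiable_on_affine_form[OF open_S])
qed

lemma twice_complex_differentiable_on_h: "twice_complex_differentiable_on S h"
  unfolding h_def[abs_def]
  by (rule twice_complex_differentiable_on_prod[OF open_S twice_complex_differentiable_on_g])

lemma twice_complex_differentiable_on_f: "twice_complex_differentiable_on S (f m)"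
  unfolding f_def[abs_def]
  by (cases m) (auto intro!: twice_complex_differentiable_on_mult twice_complex_differentiable_on_const
      twice_complex_differentiable_on_g twice_complex_differentiable_on_h open_S)

lemma d_z_g: "z \<in> S \<Longrightarrow> d_z k (g j) z = A j k * (g j z)\<^sup>2"
proof -
  assume z: "z \<in> S"
  have "complex_differentiable_at (q j) z"
    unfolding q_def[abs_def] by (rule complex_differentiable_at_affine_form)
  moreover have "d_z k (q j) z = - A j k"
    unfolding q_def[abs_def] by (rule d_z_affine_form)
  ultimately show ?thesis
    unfolding g_def[abs_def] using d_z_inverse[of "q j" z k] q_nonzero[OF z]
    by (simp add: power2_eq_square mult_ac)
qed

lemma derivative_f_Some:
  assumes "z \<in> S"
  shows "(\<Sum>k\<in>UNIV. d_z k (f (Some i)) z * v $ k) =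
    g i z * (\<Sum>k\<in>UNIV. d_z k (f None) z * v $ k) + h z * (g i z)\<^sup>2 * (\<Sum>k\<in>UNIV. A i k * v $ k)"
proof -
  have d: "h differentiable (at z)" "g i differentiable (at z)"
    using twice_complex_differentiable_on_h twice_complex_differentiable_on_g[of i] assms
    by (auto simp: twice_complex_differentiable_on_def intro: complex_differentiable_at_imp_differentiable)
  have "f None = h" "f (Some i) = (\<lambda>z. h z * g i z)"
    by (auto simp: f_def)
  then have "d_z k (f (Some i)) z = h z * (g i z)\<^sup>2 * A i k + g i z * d_z k (f None) z" for k
    using d_z_mult[OF d, of k] d_z_g[OF assms, of k i] by (simp add: mult_ac)
  then show ?thesis
    by (simp add: sum.distrib sum_distrib_left algebra_simps)
qed

text \<open>The identity of \<open>derivative_f_Some\<close> is solved for the form. Its coefficient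
  h * g^2 has modulus at least (1/B)^(CARD('n) + 2), with CARD('n) factors from h and two from the
  square; the 2 counts the two differentials, each at most \<sigma>.\<close>

lemma norm_form_le_norm_derivatives:
  assumes z: "z \<in> S" and B: "B > 0" "\<And>j. cmod (q j z) \<le> B"
  shows "cmod (\<Sum>k\<in>UNIV. A i k * v $ k) \<le>
    2 * B ^ (CARD('n) + 2) * sqrt (\<Sum>m\<in>UNIV. (cmod (\<Sum>k\<in>UNIV. d_z k (f m) z * v $ k))\<^sup>2)"
proof -
  define Q where "Q = (\<lambda>m. \<Sum>k\<in>UNIV. d_z k (f m) z * v $ k)"
  define \<sigma> where "\<sigma> = sqrt (\<Sum>m\<in>UNIV. (cmod (Q m))\<^sup>2)"
  define l where "l = (\<Sum>k\<in>UNIV. A i k * v $ k)"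
  have Q: "cmod (Q m) \<le> \<sigma>" for m
    unfolding \<sigma>_def by (rule real_le_rsqrt, rule member_le_sum) auto
  have "(1 / B) ^ (CARD('n) + 2) \<le> cmod (h z) * (cmod (g i z))\<^sup>2"
    unfolding power_add using norm_h_ge[OF z B] norm_g_ge[OF z B(2)] B(1)
    by (intro mult_mono power_mono) auto
  then have "(1 / B) ^ (CARD('n) + 2) * cmod l \<le> cmod (h z) * (cmod (g i z))\<^sup>2 * cmod l"
    by (rule mult_right_mono) simp
  also have "\<dots> = cmod (Q (Some i) - g i z * Q None)"
    using derivative_f_Some[OF z, of i v] by (simp add: Q_def l_def norm_mult norm_power)
  also have "\<dots> \<le> cmod (Q (Some i)) + cmod (g i z) * cmod (Q None)"
    by (metis norm_mult norm_triangle_ineq4)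
  also have "\<dots> \<le> \<sigma> + 1 * \<sigma>"
    using Q norm_g_le_1[OF z] by (intro add_mono mult_mono) auto
  finally have "cmod l \<le> (\<sigma> + \<sigma>) * B ^ (CARD('n) + 2)"
    using B(1) by (simp add: power_one_over field_simps del: power_Suc power_add)
  then show ?thesis
    by (simp add: \<sigma>_def l_def Q_def algebra_simps)
qed

lemma times_cont_differentiable_on_u: "times_cont_differentiable_on n S u"
proof -
  have q: "times_cont_differentiable_on n S (q j)" for j
    unfolding q_def[abs_def]
    by (intro times_cont_differentiable_on_add times_cont_differentiable_on_const
        times_cont_differentiable_on_linear bounded_linear_linear_form open_S)
  have g: "times_cont_differentiable_on n S (g j)" for j
    unfolding g_def[abs_def]
    by (rule times_cont_differentiable_on_inverse[OF open_S q_nonzero q])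
  have h: "times_cont_differentiable_on n S h"
    unfolding h_def[abs_def] by (rule times_cont_differentiable_on_prod[OF open_S g])
  have f: "times_cont_differentiable_on n S (f m)" for m
    unfolding f_def[abs_def]
    by (cases m) (auto intro!: times_cont_differentiable_on_mult times_cont_differentiable_on_const
        g h open_S)
  have "times_cont_differentiable_on n S (\<lambda>z. \<Sum>m\<in>UNIV. Re (f m z * cnj (f m z)))"
    by (intro times_cont_differentiable_on_sum times_cont_differentiable_on_mult f open_S
        times_cont_differentiable_on_linear_compose[OF open_S bounded_linear_Re]
        times_cont_differentiable_on_linear_compose[OF open_S bounded_linear_cnj])
  then show ?thesis
    by (simp only: complex_norm_square[symmetric] Re_complex_of_real u_def[abs_def])
qed

end

section \<open>Choice of the uniform constants and assembly\<close>

theorem proposition13p1: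
  fixes a r :: real
  assumes "a > 0" and "0 < r" and "r \<le> 1"
  shows "\<exists>C b :: real. C > 0 \<and> b > 0 \<and>
    (\<forall>\<Omega> :: (complex ^ 'n::{finite,linorder}) set. \<Omega> \<in> K_class r \<longrightarrow>
      (\<exists>F :: complex ^ 'n::{finite,linorder} \<Rightarrow> real.
         smooth_on \<Omega> F \<and> plurisubharmonic_on \<Omega> F \<and> F ` \<Omega> \<subseteq> {0..1} \<and>
         (\<forall>z \<in> ball (std_basis first_index) a \<inter> \<Omega>. \<forall>v.
            levi_form F z v \<ge> C * levi_form (\<lambda>w. (norm w)\<^sup>2) z v) \<and>
         support_in \<Omega> F \<subseteq> ball (std_basis first_index) b \<inter> \<Omega>))"
proof -
  define d where "d = real CARD('n)"
  \<comment> \<open>\<open>M\<close> is the constant of \<open>triangular_system_bound\<close> with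
    R = 1/r. \<open>B\<close> bounds all \<open>q j\<close> on the ball of radius a, so u >=
    \<delta> there by \<open>u_ge\<close>.\<close>
  define M where "M = d * (1 + d * (1 / r)) ^ CARD('n)"
  define B where "B = 2 + d * (1 / r) * (1 + a)"
  define \<delta> where "\<delta> = ((1 / B) ^ CARD('n))\<^sup>2"
  \<comment> \<open>\<open>T\<close> bounds the forms wherever u > \<delta>/2, so such points have
    norm at most M * T. In \<open>b\<close>, one unit covers the norm of the centre and one makes
    the inclusion strict.\<close>
  define T where "T = 2 + sqrt (2 * (1 + d) / \<delta>)"
  define b where "b = M * T + 2"
  \<comment> \<open>Scales \<phi> into [0,1] on the range of u, as convex_cutoff s <= s for s > 0
    and u <= 1 + d.\<close>
  define c where "c = 1 / (1 + d)"
  define \<phi> where "\<phi> = (\<lambda>t. c * convex_cutoff (t - \<delta> / 2))"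
  define \<phi>' where "\<phi>' = (\<lambda>t. c * (flat_exp 0 (t - \<delta> / 2) + flat_exp 1 (t - \<delta> / 2)))"
  define \<phi>'' where "\<phi>'' = (\<lambda>t. c * flat_exp 3 (t - \<delta> / 2))"
  \<comment> \<open>\<open>M * (2 * B ^ (CARD('n) + 2))\<close> is the factor by which the norm of v
    is controlled through the differentials, and \<phi>' >= \<phi>' \<delta> where u >=
    \<delta>.\<close>
  define C where "C = \<phi>' \<delta> / (M * (2 * B ^ (CARD('n) + 2)))\<^sup>2"
  have d: "d > 0" by (simp add: d_def)
  have M: "M > 0" using d assms by (simp add: M_def add_pos_pos)
  have B: "B > 0" using d assms by (simp add: B_def add_pos_pos)
  have \<delta>: "\<delta> > 0" using B by (simp add: \<delta>_def)
  have T: "T > 0" using d \<delta> by (simp add: T_def add_pos_nonneg)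
  have c: "c > 0" using d by (simp add: c_def)
  have b: "b > 0" using M T by (simp add: b_def add_pos_pos)
  have "\<phi>' \<delta> > 0"
    using c \<delta> by (simp add: \<phi>'_def flat_exp_def add_pos_pos)
  then have C: "C > 0" using M B by (simp add: C_def)
  have \<phi>_deriv: "(\<phi> has_real_derivative \<phi>' t) (at t)" for t
    unfolding \<phi>_def \<phi>'_def
    by (rule derivative_eq_intros DERIV_chain2[OF convex_cutoff_has_derivative] refl | simp)+
  have \<phi>'_deriv: "(\<phi>' has_real_derivative \<phi>'' t) (at t)" for t
  proof -
    have "((\<lambda>t. t - \<delta> / 2) has_real_derivative 1) (at t)"
      by (auto intro!: derivative_eq_intros)
    from DERIV_cmult[OF DERIV_chain2[OF convex_cutoff_has_second_derivative this], of c]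
    show ?thesis by (simp add: \<phi>'_def \<phi>''_def)
  qed
  have \<phi>_tangent: "\<phi> s + \<phi>' s * (t - s) \<le> \<phi> t" for s t
    using mult_left_mono[OF convex_cutoff_above_tangent[of "s - \<delta> / 2" "t - \<delta> / 2"] less_imp_le[OF c]]
    by (simp add: \<phi>_def \<phi>'_def algebra_simps)
  have \<phi>'_nonneg: "\<phi>' t \<ge> 0" and \<phi>''_nonneg: "\<phi>'' t \<ge> 0" for t
    using c by (simp_all add: \<phi>'_def \<phi>''_def flat_exp_nonneg)
  have \<phi>'_mono: "\<phi>' s \<le> \<phi>' t" if "s \<le> t" for s t
    unfolding \<phi>'_def using c that by (intro mult_left_mono convex_cutoff_derivative_mono) auto
  have \<phi>_zero: "\<phi> t = 0" if "t \<le> \<delta> / 2" for t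
    using that by (simp add: \<phi>_def convex_cutoff_def flat_exp_def)
  have \<phi>_range: "\<phi> t \<in> {0..1}" if "t \<le> 1 + d" for t
  proof (cases "t \<le> \<delta> / 2")
    case True
    then show ?thesis by (simp add: \<phi>_zero)
  next
    case False
    define s where "s = t - \<delta> / 2"
    have s: "s > 0" "s \<le> 1 + d" using False that \<delta> by (simp_all add: s_def)
    have "s * exp (- 1 / s) \<le> (1 + d) * 1"
      using s by (intro mult_mono) auto
    then show ?thesis
      using s d by (simp add: \<phi>_def c_def s_def[symmetric] convex_cutoff_def flat_exp_def)
  qed
  have "\<exists>F :: complex ^ 'n::{finite,linorder} \<Rightarrow> real.
         smooth_on \<Omega> F \<and> plurisubharmonic_on \<Omega> F \<and> F ` \<Omega> \<subseteq> {0..1} \<and>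
         (\<forall>z \<in> ball (std_basis first_index) a \<inter> \<Omega>. \<forall>v.
            levi_form F z v \<ge> C * levi_form (\<lambda>w. (norm w)\<^sup>2) z v) \<and>
         support_in \<Omega> F \<subseteq> ball (std_basis first_index) b \<inter> \<Omega>"
    if \<Omega>: "\<Omega> \<in> K_class r" for \<Omega> :: "(complex ^ 'n::{finite,linorder}) set"
  proof -
    have "open \<Omega>" using \<Omega> by (simp add: K_class_def C_properly_convex_def)
    obtain A :: "'n \<Rightarrow> 'n \<Rightarrow> complex" where
      A: "\<And>j z. z \<in> \<Omega> \<Longrightarrow> Re (\<Sum>k\<in>UNIV. A j k * z $ k) < 1" "\<And>j k. j < k \<Longrightarrow> A j k = 0"
        "\<And>j. cmod (A j j) \<ge> 1" "\<And>j k. cmod (A j k) \<le> 1 / r"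
      using K_class_supporting_form[OF \<Omega> assms(2,3)] by metis
    interpret half_space_domain \<Omega> A
      by unfold_locales (use \<open>open \<Omega>\<close> A(1) in auto)
    have inverse_bound: "norm v \<le> M * t" if "\<And>j. cmod (\<Sum>k\<in>UNIV. A j k * v $ k) \<le> t" for v t
      unfolding M_def d_def by (rule triangular_system_bound[OF A(2-4) that])
    have q_le: "cmod (q j z) \<le> B" if "z \<in> ball (std_basis first_index) a" for j z
    proof -
      have "norm z \<le> norm (std_basis first_index :: complex ^ 'n::{finite,linorder}) + norm (z - std_basis first_index)"
        by (rule norm_triangle_sub)
      then have z: "norm z \<le> 1 + a"
        using that by (simp add: norm_std_basis dist_norm norm_minus_commute)
      have "cmod (\<Sum>k\<in>UNIV. A j k * z $ k) \<le> (\<Sum>k\<in>(UNIV::'n set). (1 / r) * (1 + a))"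
      proof (rule sum_norm_le)
        fix k
        show "cmod (A j k * z $ k) \<le> (1 / r) * (1 + a)"
          unfolding norm_mult using A(4) z order_trans[OF Finite_Cartesian_Product.norm_nth_le[of z k]] assms
          by (intro mult_mono) auto
      qed
      then have "cmod (\<Sum>k\<in>UNIV. A j k * z $ k) \<le> B - 2"
        by (simp add: B_def d_def)
      then show ?thesis
        using norm_triangle_ineq4[of 2 "\<Sum>k\<in>UNIV. A j k * z $ k"] by (simp add: q_eq)
    qed
    define F where "F = (\<lambda>z. \<phi> (u z))"
    have "times_cont_differentiable_on n \<Omega> F" for n
      unfolding F_def \<phi>_def convex_cutoff_def diff_conv_add_uminus
      by (intro times_cont_differentiable_on_mult times_cont_differentiable_on_const
          times_cont_differentiable_on_flat_exp times_cont_differentiable_on_add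
          times_cont_differentiable_on_u open_S)
    then have "smooth_on \<Omega> F" by (simp add: smooth_on_def)
    moreover have "plurisubharmonic_on \<Omega> F"
      unfolding F_def u_def using twice_complex_differentiable_on_f
      by (intro plurisubharmonic_on_compose_sum_norm_square[OF _ \<phi>_deriv \<phi>_tangent \<phi>'_nonneg])
        (auto simp: twice_complex_differentiable_on_def)
    moreover have "F ` \<Omega> \<subseteq> {0..1}"
      using \<phi>_range u_le_const by (auto simp: F_def d_def)
    moreover have "levi_form F z v \<ge> C * levi_form (\<lambda>w. (norm w)\<^sup>2) z v"
      if z: "z \<in> ball (std_basis first_index) a" "z \<in> \<Omega>" for z v
    proof -
      define \<sigma> where "\<sigma> = (\<Sum>m\<in>UNIV. (cmod (\<Sum>k\<in>UNIV. d_z k (f m) z * v $ k))\<^sup>2)"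
      have \<sigma>: "\<sigma> \<ge> 0" unfolding \<sigma>_def by (intro sum_nonneg) auto
      \<comment> \<open>The differentials control all forms at v, and the triangular system then
        controls v itself.\<close>
      have "norm v \<le> M * (2 * B ^ (CARD('n) + 2) * sqrt \<sigma>)"
        unfolding \<sigma>_def by (intro inverse_bound norm_form_le_norm_derivatives q_le z B)
      then have "(norm v)\<^sup>2 \<le> (M * (2 * B ^ (CARD('n) + 2) * sqrt \<sigma>))\<^sup>2"
        by (intro power_mono) auto
      also have "\<dots> = (M * (2 * B ^ (CARD('n) + 2)))\<^sup>2 * \<sigma>"
        using \<sigma> by (simp add: power_mult_distrib mult.assoc)
      finally have v: "(norm v)\<^sup>2 \<le> (M * (2 * B ^ (CARD('n) + 2)))\<^sup>2 * \<sigma>" .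
      have "C * (norm v)\<^sup>2 \<le> C * ((M * (2 * B ^ (CARD('n) + 2)))\<^sup>2 * \<sigma>)"
        using v C by (intro mult_left_mono) auto
      also have "\<dots> = \<phi>' \<delta> * \<sigma>"
        using M B by (simp add: C_def)
      also have "\<dots> \<le> \<phi>' (u z) * \<sigma>"
        using u_ge[OF z(2) B q_le[OF z(1)]] \<sigma> by (intro mult_right_mono \<phi>'_mono) (simp_all add: \<delta>_def)
      \<comment> \<open>The \<phi>'' term of the Levi form is nonnegative and is dropped.\<close>
      also have "\<dots> \<le> levi_form F z v"
        unfolding F_def u_def \<sigma>_def
        using levi_form_compose_sum_norm_square[where f=f and I=UNIV and v=v, OF open_S z(2) twice_complex_differentiable_on_f
            \<phi>_deriv \<phi>'_deriv] \<phi>''_nonneg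
        by simp
      finally show ?thesis by (simp add: levi_form_norm_square)
    qed
    moreover have "support_in \<Omega> F \<subseteq> ball (std_basis first_index) b \<inter> \<Omega>"
    proof -
      have "norm z \<le> M * T" if z: "z \<in> \<Omega>" "F z \<noteq> 0" for z
      proof (rule inverse_bound)
        fix j
        have "\<delta> / 2 < u z"
          using z(2) \<phi>_zero[of "u z"] by (force simp: F_def)
        also have "\<dots> \<le> (cmod (g j z))\<^sup>2 * (1 + d)"
          using u_le[OF z(1)] by (simp add: d_def)
        also have "\<dots> = (1 + d) / (cmod (q j z))\<^sup>2"
          by (simp add: g_def norm_inverse power_inverse divide_inverse mult.commute)
        finally have "(cmod (q j z))\<^sup>2 \<le> 2 * (1 + d) / \<delta>"
          using q_nonzero[OF z(1), of j] \<delta> by (simp add: field_simps)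
        then have "cmod (q j z) \<le> sqrt (2 * (1 + d) / \<delta>)"
          by (rule real_le_rsqrt)
        then show "cmod (\<Sum>k\<in>UNIV. A j k * z $ k) \<le> T"
          using norm_triangle_ineq4[of 2 "q j z"] by (simp add: q_eq T_def)
      qed
      \<comment> \<open>A closed ball is used so that the bound survives taking the closure in the
        definition of the support.\<close>
      then have "{z \<in> \<Omega>. F z \<noteq> 0} \<subseteq> cball 0 (M * T)" by auto
      then have "closure {z \<in> \<Omega>. F z \<noteq> 0} \<subseteq> cball 0 (M * T)"
        by (rule closure_minimal) simp
      moreover have "cball 0 (M * T) \<subseteq> ball (std_basis first_index :: complex ^ 'n::{finite,linorder}) b"
      proof
        fix z :: "complex ^ 'n::{finite,linorder}" assume "z \<in> cball 0 (M * T)"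
        then show "z \<in> ball (std_basis first_index) b"
          using norm_triangle_ineq4[of "std_basis first_index" z] by (simp add: norm_std_basis dist_norm b_def)
      qed
      ultimately show ?thesis by (auto simp: support_in_def)
    qed
    ultimately show ?thesis by blast
  qed
  with C b show ?thesis by blast
qed

end
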